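(* Let $p$ be a prime number, $K$ a number field, and let $S=S_0\cup S_\infty$ and $T$ be finite disjoint sets of places of $K$, where $S_0$ and $T$ consist of non-archimedean places and $S_\infty$ consists of real places. Assume $N_v\equiv 1\pmod p$ for all $v\in T$ and, if $p>2$, that $S_\infty$ is the set of all real places of $K$. For each $v\in T$ choose a place $w\mid v$ of $K'=K(\zeta_p)$ and let $\sigma_v\in\Gamma^S=\mathrm{Gal}(F^S/K')$ be the Frobenius at $w$ in $F^S/K'$. Let $H_T=\sum_{v\in T}\mathbb F_p\,\sigma_v\subset\Gamma^S$. If the family $(\sigma_v)_{v\in T}$ is linearly independent over $\mathbb F_p$ in $\Gamma^S$, then $$\Gamma_T^S\simeq\Gamma^S/H_T.$$
   Context: $N_v$ is the cardinality of the residue field at $v$. $\iota_v$ is the embedding of $K$ into $K_v$. $E_T^S$ is the group of $x\in K^\times$ such that $x\equiv 1\pmod v$ for all $v\in T$, $v(x)=0$ for all finite places $v\notin S$, and $\iota_v(x)>0$ for all real places $v\notin S$; $E^S=E_\emptyset^S$. $\zeta_p$ is a primitive $p$th root of unity, $K'=K(\zeta_p)$. Put $F_T^S=K'(\sqrt[p]{E_T^S})$, $\Gamma_T^S=\mathrm{Gal}(F_T^S/K')$, and $F^S=F_\emptyset^S$, $\Gamma^S=\Gamma_\emptyset^S$. These Galois groups are elementary abelian $p$-groups, viewed as $\mathbb F_p$-vector spaces (written additively). Places of $T$ are prime to $p$ and not in $S$, hence unramified in $F^S/K'$. *)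

theory Defs
  imports
    "HOL-Algebra.Algebraic_Closure_Type"
    "HOL-Algebra.Embedded_Algebras"
    "HOL-Algebra.Generated_Fields"
    "HOL-Algebra.QuotRing"
    "HOL-Algebra.Bij"
    "HOL-Number_Theory.Cong"
    Complex_Main
begin

text \<open>
  All fields are subfields (as sets) of one ambient algebraically closed field of characteristic
  zero, namely the type \<open>'a\<close>. It contains in particular the $p$-th roots of unity and all
  $p$-th roots of elements of the base field.
\<close>

abbreviation on_carrier :: "'a::ring_1 set \<Rightarrow> 'a ring" where
  "on_carrier A \<equiv> ring_of_type_algebra \<lparr>carrier := A\<rparr>"

definition number_field :: "'a::field_char_0 set \<Rightarrow> bool" where
  "number_field K \<longleftrightarrow>
     subfield K ring_of_type_algebra \<and> ring.finite_dimension ring_of_type_algebra \<rat> K"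


section \<open>Places\<close>

text \<open>
  A non-archimedean place of a number field is given by its normalised discrete valuation
  \<open>v : K\<^sup>\<times> \<rightarrow> \<int>\<close>, a real place by its embedding $\iota_v$ into \<open>K\<^sub>v = \<real>\<close>. Both are extensional
  functions, so that distinct functions are distinct places. The value \<open>v 0 = \<infinity>\<close> is not
  represented; the zero element is treated separately where it matters.
\<close>

definition finite_places :: "'a::field set \<Rightarrow> ('a \<Rightarrow> int) set" where
  "finite_places K = {v \<in> extensional (K - {0}).
     v ` (K - {0}) = UNIV \<and>
     (\<forall>x \<in> K - {0}. \<forall>y \<in> K - {0}. v (x * y) = v x + v y) \<and>
     (\<forall>x \<in> K - {0}. \<forall>y \<in> K - {0}. x + y \<noteq> 0 \<longrightarrow> min (v x) (v y) \<le> v (x + y))}"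

definition real_places :: "'a::field set \<Rightarrow> ('a \<Rightarrow> real) set" where
  "real_places K = ring_hom (on_carrier K) ring_of_type_algebra \<inter> extensional K"

definition valuation_ring :: "'a::field set \<Rightarrow> ('a \<Rightarrow> int) \<Rightarrow> 'a set" where
  "valuation_ring K v = {x \<in> K. x = 0 \<or> 0 \<le> v x}"

definition valuation_ideal :: "'a::field set \<Rightarrow> ('a \<Rightarrow> int) \<Rightarrow> 'a set" where
  "valuation_ideal K v = {x \<in> K. x = 0 \<or> 0 < v x}"

definition residue_field :: "'a::field set \<Rightarrow> ('a \<Rightarrow> int) \<Rightarrow> 'a set ring" where
  "residue_field K v = on_carrier (valuation_ring K v) Quot valuation_ideal K v"

definition place_norm :: "'a::field set \<Rightarrow> ('a \<Rightarrow> int) \<Rightarrow> nat" where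
  "place_norm K v = card (carrier (residue_field K v))"

text \<open>For a place \<open>w\<close> of an extension of \<open>K\<close> and a place \<open>v\<close> of \<open>K\<close>: \<open>w\<close> lies over \<open>v\<close>,
  the number \<open>e\<close> being the ramification index.\<close>

definition lies_over :: "'a::field set \<Rightarrow> ('a \<Rightarrow> int) \<Rightarrow> ('a \<Rightarrow> int) \<Rightarrow> bool" where
  "lies_over K w v \<longleftrightarrow> (\<exists>e > 0. \<forall>x \<in> K - {0}. w x = e * v x)"


section \<open>Galois groups and Frobenius elements\<close>

definition gal_group :: "'a::field set \<Rightarrow> 'a set \<Rightarrow> ('a \<Rightarrow> 'a) monoid" where
  "gal_group L K = BijGroup L
     \<lparr>carrier := {\<tau> \<in> ring_iso (on_carrier L) (on_carrier L) \<inter> extensional L. \<forall>x \<in> K. \<tau> x = x}\<rparr>"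

text \<open>
  \<open>\<tau>\<close> is the Frobenius at the place \<open>w\<close> of \<open>K\<close> in \<open>L/K\<close>, for \<open>L/K\<close> abelian and unramified at \<open>w\<close>.
  The Frobenius at a place \<open>W\<close> of \<open>L\<close> over \<open>w\<close> is the only automorphism satisfying the congruence,
  and as \<open>L/K\<close> is abelian it is the same for all \<open>W\<close> over \<open>w\<close>, so that it does not matter
  which \<open>W\<close> is used.
\<close>

definition is_frobenius :: "'a::field set \<Rightarrow> 'a set \<Rightarrow> ('a \<Rightarrow> int) \<Rightarrow> ('a \<Rightarrow> 'a) \<Rightarrow> bool" where
  "is_frobenius L K w \<tau> \<longleftrightarrow> \<tau> \<in> carrier (gal_group L K) \<and>
     (\<exists>W \<in> finite_places L. lies_over K W w \<and>
        (\<forall>x \<in> valuation_ring L W. \<tau> x - x ^ place_norm K w \<in> valuation_ideal L W))"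


section \<open>Elementary abelian groups as \<open>\<bbbF>\<^sub>p\<close>-vector spaces\<close>

text \<open>
  An abelian group \<open>G\<close> of exponent dividing \<open>p\<close> is an \<open>\<bbbF>\<^sub>p\<close>-vector space, with the class of
  \<open>n\<close> modulo \<open>p\<close> acting by \<open>g \<mapsto> g\<^sup>n\<close>. Scalars are represented by \<open>0, \<dots>, p - 1\<close>,
  and \<open>G\<close> is written multiplicatively.
\<close>

definition fp_lincomb ::
  "('g, 'm) monoid_scheme \<Rightarrow> ('i \<Rightarrow> 'g) \<Rightarrow> 'i set \<Rightarrow> ('i \<Rightarrow> nat) \<Rightarrow> 'g" where
  "fp_lincomb G s I c = finprod G (\<lambda>i. s i [^]\<^bsub>G\<^esub> c i) I"

definition fp_span :: "nat \<Rightarrow> ('g, 'm) monoid_scheme \<Rightarrow> ('i \<Rightarrow> 'g) \<Rightarrow> 'i set \<Rightarrow> 'g set" where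
  "fp_span p G s I = fp_lincomb G s I ` (I \<rightarrow> {..<p})"

definition fp_independent :: "nat \<Rightarrow> ('g, 'm) monoid_scheme \<Rightarrow> ('i \<Rightarrow> 'g) \<Rightarrow> 'i set \<Rightarrow> bool" where
  "fp_independent p G s I \<longleftrightarrow>
     (\<forall>c \<in> I \<rightarrow> {..<p}. fp_lincomb G s I c = \<one>\<^bsub>G\<^esub> \<longrightarrow> (\<forall>i \<in> I. c i = 0))"


section \<open>The groups \<open>E\<^sub>T\<^sup>S\<close> and \<open>\<Gamma>\<^sub>T\<^sup>S\<close>\<close>

definition primitive_root :: "nat \<Rightarrow> 'a::field \<Rightarrow> bool" where
  "primitive_root n z \<longleftrightarrow> z ^ n = 1 \<and> (\<forall>k. 0 < k \<and> k < n \<longrightarrow> z ^ k \<noteq> 1)"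

definition adjoin :: "'a::field set \<Rightarrow> 'a set \<Rightarrow> 'a set" where
  "adjoin K A = generate_field ring_of_type_algebra (K \<union> A)"

text \<open>A set \<open>S\<close> of places is passed as the pair of its finite part \<open>S\<^sub>0\<close> and its real part
  \<open>S\<^sub>r\<close>.\<close>

definition E_group ::
  "'a::field set \<Rightarrow> ('a \<Rightarrow> int) set \<Rightarrow> ('a \<Rightarrow> int) set \<Rightarrow> ('a \<Rightarrow> real) set \<Rightarrow> 'a set" where
  "E_group K T S\<^sub>0 S\<^sub>r = {x \<in> K - {0}.
     (\<forall>v \<in> T. x - 1 \<in> valuation_ideal K v) \<and>
     (\<forall>v \<in> finite_places K - S\<^sub>0. v x = 0) \<and>
     (\<forall>v \<in> real_places K - S\<^sub>r. 0 < v x)}"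

definition F_field ::
  "nat \<Rightarrow> 'a::field \<Rightarrow> 'a set \<Rightarrow> ('a \<Rightarrow> int) set \<Rightarrow> ('a \<Rightarrow> int) set \<Rightarrow> ('a \<Rightarrow> real) set \<Rightarrow> 'a set" where
  "F_field p \<zeta> K T S\<^sub>0 S\<^sub>r = adjoin (adjoin K {\<zeta>}) {y. y ^ p \<in> E_group K T S\<^sub>0 S\<^sub>r}"

definition Gamma_group ::
  "nat \<Rightarrow> 'a::field \<Rightarrow> 'a set \<Rightarrow> ('a \<Rightarrow> int) set \<Rightarrow> ('a \<Rightarrow> int) set \<Rightarrow> ('a \<Rightarrow> real) set
    \<Rightarrow> ('a \<Rightarrow> 'a) monoid" where
  "Gamma_group p \<zeta> K T S\<^sub>0 S\<^sub>r = gal_group (F_field p \<zeta> K T S\<^sub>0 S\<^sub>r) (adjoin K {\<zeta>})"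

end

theory Submission
  imports Defs
begin

text \<open>
  Write \<open>K' = K(\<zeta>)\<close>. An automorphism \<open>\<tau>\<close> in \<open>\<Gamma>\<^sup>S\<close> multiplies a $p$-th root \<open>y\<close> of an element of \<open>E\<^sup>S\<close>
  by a $p$-th root of unity. By duality over \<open>\<bbbF>\<^sub>p\<close>, independence of the \<open>\<sigma>\<^sub>v\<close> means that the roots
  of unity \<open>\<sigma>\<^sub>v y / y\<close> (\<open>v \<in> T\<close>) can be prescribed freely.

  Let \<open>D\<close> be the group of those \<open>x \<in> E\<^sup>S\<close> whose $p$-th roots are fixed by all \<open>\<sigma>\<^sub>v\<close>. It contains
  \<open>E\<^sub>T\<^sup>S\<close>: if \<open>y\<^sup>p\<close> is congruent to \<open>1\<close> at \<open>v\<close> then \<open>y\<close> is congruent to some \<open>\<zeta>\<^sup>i\<close>, and \<open>\<sigma>\<^sub>v\<close> preserves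
  this because it acts as a power map on residues. The group \<open>E\<^sup>S/E\<^sub>T\<^sup>S\<close> is finite, its
  $p$-torsion has at most \<open>p\<^bsup>|T|\<^esup>\<close> elements since its elements are congruent to roots of unity
  at every place of \<open>T\<close>, and \<open>D\<close> has index at least \<open>p\<^bsup>|T|\<^esup>\<close>. Comparing with the $p$-th power map gives
  \<open>D = E\<^sub>T\<^sup>S (E\<^sup>S)\<^sup>p\<close>.

  Hence an automorphism that is trivial on \<open>F\<^sub>T\<^sup>S\<close> is determined by its values at roots \<open>y\<^sub>u\<close> dual to
  the \<open>\<sigma>\<^sub>v\<close>, so it lies in \<open>H\<^sub>T\<close>. Moreover \<open>F\<^sup>S\<close> is generated over \<open>F\<^sub>T\<^sup>S\<close> by the finitely many \<open>y\<^sub>u\<close>, so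
  automorphisms of \<open>F\<^sub>T\<^sup>S\<close> extend to \<open>F\<^sup>S\<close> one \<open>y\<^sub>u\<close> at a time.
\<close>

section \<open>Subfields and their automorphisms\<close>

abbreviation ambient_subfield :: "'a::field set \<Rightarrow> bool" where
  "ambient_subfield K \<equiv> subfield K (ring_of_type_algebra :: 'a ring)"

lemma type_ring_simps [simp]:
  "carrier ring_of_type_algebra = UNIV"
  "x \<otimes>\<^bsub>ring_of_type_algebra\<^esub> y = x * y"
  "x \<oplus>\<^bsub>ring_of_type_algebra\<^esub> y = x + y"
  "\<one>\<^bsub>ring_of_type_algebra\<^esub> = 1"
  "\<zero>\<^bsub>ring_of_type_algebra\<^esub> = 0"
  by (simp_all add: ring_of_type_algebra_def)

lemma type_ring_a_inv [simp]: "\<ominus>\<^bsub>ring_of_type_algebra\<^esub> x = - (x :: 'a::field)"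
proof -
  interpret cring "ring_of_type_algebra :: 'a ring" by (rule cring_from_type_algebra)
  show ?thesis
    by (rule minus_equality) auto
qed

lemma type_ring_m_inv [simp]:
  assumes "(x :: 'a::field) \<noteq> 0"
  shows "inv\<^bsub>ring_of_type_algebra\<^esub> x = inverse x"
proof -
  interpret cring "ring_of_type_algebra :: 'a ring" by (rule cring_from_type_algebra)
  show ?thesis
    by (rule comm_inv_char) (use assms in auto)
qed

lemma subfield_closed:
  assumes "ambient_subfield K"
  shows "0 \<in> K" "1 \<in> K"
    and "\<And>x y. x \<in> K \<Longrightarrow> y \<in> K \<Longrightarrow> x + y \<in> K"
    and "\<And>x y. x \<in> K \<Longrightarrow> y \<in> K \<Longrightarrow> x * y \<in> K"
    and "\<And>x. x \<in> K \<Longrightarrow> - x \<in> K"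
    and "\<And>x y. x \<in> K \<Longrightarrow> y \<in> K \<Longrightarrow> x - y \<in> K"
    and "\<And>x. x \<in> K \<Longrightarrow> inverse x \<in> K"
    and "\<And>x y. x \<in> K \<Longrightarrow> y \<in> K \<Longrightarrow> x / y \<in> K"
    and "\<And>x n. x \<in> K \<Longrightarrow> x ^ n \<in> K"
    and "\<And>n. of_nat n \<in> K"
    and "\<And>f (I :: 'i set). (\<And>i. i \<in> I \<Longrightarrow> f i \<in> K) \<Longrightarrow> sum f I \<in> K"
    and "\<And>f (I :: 'i set). (\<And>i. i \<in> I \<Longrightarrow> f i \<in> K) \<Longrightarrow> prod f I \<in> K"
proof -
  interpret field "ring_of_type_algebra :: 'a ring" by (rule field_from_type_algebra)
  note sub = subringE[OF subfieldE(1)[OF assms]]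
  show zero: "0 \<in> K" and one: "1 \<in> K" using sub(2,3) by simp_all
  show add: "x + y \<in> K" if "x \<in> K" "y \<in> K" for x y using sub(7)[OF that] by simp
  show mult: "x * y \<in> K" if "x \<in> K" "y \<in> K" for x y using sub(6)[OF that] by simp
  show minus: "- x \<in> K" if "x \<in> K" for x using sub(5)[OF that] by simp
  show "x - y \<in> K" if "x \<in> K" "y \<in> K" for x y
    using add[OF that(1) minus[OF that(2)]] by simp
  show inv: "inverse x \<in> K" if "x \<in> K" for x
    using subfield_m_inv(1)[OF assms, of x] that zero by (cases "x = 0") auto
  show "x / y \<in> K" if "x \<in> K" "y \<in> K" for x y
    using mult[OF that(1) inv[OF that(2)]] by (simp add: divide_inverse)
  show "x ^ n \<in> K" if "x \<in> K" for x n by (induction n) (auto simp: one that mult)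
  show "of_nat n \<in> K" for n by (induction n) (auto simp: zero one add)
  show "sum f I \<in> K" if "\<And>i. i \<in> I \<Longrightarrow> f i \<in> K" for f and I :: "'i set"
    using that by (induction I rule: infinite_finite_induct) (auto simp: zero add)
  show "prod f I \<in> K" if "\<And>i. i \<in> I \<Longrightarrow> f i \<in> K" for f and I :: "'i set"
    using that by (induction I rule: infinite_finite_induct) (auto simp: one mult)
qed

section \<open>Fields generated by adjoining elements\<close>

lemma adjoin_subfield: "ambient_subfield (adjoin K A)"
  unfolding adjoin_def
  by (rule field.generate_field_is_subfield[OF field_from_type_algebra]) simp

lemma adjoin_incl: "K \<subseteq> adjoin K A" "A \<subseteq> adjoin K A"
  unfolding adjoin_def by (auto intro: generate_field.incl)

lemma adjoin_least:
  assumes "ambient_subfield M" "K \<subseteq> M" "A \<subseteq> M"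
  shows "adjoin K A \<subseteq> M"
  unfolding adjoin_def
  by (rule field.generate_field_min_subfield1[OF field_from_type_algebra]) (use assms in auto)

lemma adjoin_mono: "A \<subseteq> B \<Longrightarrow> adjoin K A \<subseteq> adjoin K B"
  by (rule adjoin_least[OF adjoin_subfield adjoin_incl(1)]) (use adjoin_incl(2) in blast)

text \<open>Lets finitely many elements be adjoined one at a time, so that automorphisms can be
  extended by induction.\<close>

lemma adjoin_insert: "adjoin K (insert y A) = adjoin (adjoin K A) {y}"
proof
  show "adjoin K (insert y A) \<subseteq> adjoin (adjoin K A) {y}"
    by (rule adjoin_least[OF adjoin_subfield])
      (use adjoin_incl(1)[of K A] adjoin_incl(2)[of A K] adjoin_incl(1)[of "adjoin K A" "{y}"]
          adjoin_incl(2)[of "{y}" "adjoin K A"] in auto)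
  show "adjoin (adjoin K A) {y} \<subseteq> adjoin K (insert y A)"
    by (rule adjoin_least[OF adjoin_subfield])
      (use adjoin_mono[of A "insert y A" K] adjoin_incl(2)[of "insert y A" K] in auto)
qed

lemma adjoin_induct [consumes 1, case_names one base gen minus inverse add mult]:
  assumes "x \<in> adjoin K A"
    and "P 1" "\<And>x. x \<in> K \<Longrightarrow> P x" "\<And>x. x \<in> A \<Longrightarrow> P x"
    and "\<And>x. x \<in> adjoin K A \<Longrightarrow> P x \<Longrightarrow> P (- x)"
    and "\<And>x. x \<in> adjoin K A \<Longrightarrow> P x \<Longrightarrow> x \<noteq> 0 \<Longrightarrow> P (inverse x)"
    and "\<And>x y. x \<in> adjoin K A \<Longrightarrow> P x \<Longrightarrow> y \<in> adjoin K A \<Longrightarrow> P y \<Longrightarrow> P (x + y)"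
    and "\<And>x y. x \<in> adjoin K A \<Longrightarrow> P x \<Longrightarrow> y \<in> adjoin K A \<Longrightarrow> P y \<Longrightarrow> P (x * y)"
  shows "P x"
  using assms(1) unfolding adjoin_def
  by (induction rule: generate_field.induct)
    (use assms(2-) in \<open>auto simp flip: adjoin_def\<close>)

section \<open>Automorphisms of subfields of the ambient field\<close>

abbreviation field_auts :: "'a::field set \<Rightarrow> ('a \<Rightarrow> 'a) set" where
  "field_auts L \<equiv> ring_iso (on_carrier L) (on_carrier L)"

lemma field_auts_iff:
  "\<tau> \<in> field_auts L \<longleftrightarrow> (\<forall>x\<in>L. \<forall>y\<in>L. \<tau> (x + y) = \<tau> x + \<tau> y \<and> \<tau> (x * y) = \<tau> x * \<tau> y) \<and>
    \<tau> 1 = 1 \<and> bij_betw \<tau> L L"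
  by (auto simp: ring_iso_def ring_hom_def bij_betw_def)

lemma field_aut_simps:
  assumes "ambient_subfield L" "\<tau> \<in> field_auts L"
  shows "\<tau> 0 = 0" "\<tau> 1 = 1" "inj_on \<tau> L" "\<tau> ` L = L"
    and "\<And>x. x \<in> L \<Longrightarrow> \<tau> x \<in> L"
    and "\<And>x y. x \<in> L \<Longrightarrow> y \<in> L \<Longrightarrow> \<tau> (x + y) = \<tau> x + \<tau> y"
    and "\<And>x y. x \<in> L \<Longrightarrow> y \<in> L \<Longrightarrow> \<tau> (x * y) = \<tau> x * \<tau> y"
    and "\<And>x. x \<in> L \<Longrightarrow> \<tau> (- x) = - \<tau> x"
    and "\<And>x. x \<in> L \<Longrightarrow> \<tau> (inverse x) = inverse (\<tau> x)"
    and "\<And>x y. x \<in> L \<Longrightarrow> y \<in> L \<Longrightarrow> \<tau> (x / y) = \<tau> x / \<tau> y"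
    and "\<And>x n. x \<in> L \<Longrightarrow> \<tau> (x ^ n) = \<tau> x ^ n"
    and "\<And>f (I :: 'i set). (\<And>i. i \<in> I \<Longrightarrow> f i \<in> L) \<Longrightarrow> \<tau> (sum f I) = (\<Sum>i\<in>I. \<tau> (f i))"
    and "\<And>f (I :: 'i set). (\<And>i. i \<in> I \<Longrightarrow> f i \<in> L) \<Longrightarrow> \<tau> (prod f I) = (\<Prod>i\<in>I. \<tau> (f i))"
proof -
  note K = subfield_closed[OF assms(1)]
  show add: "\<tau> (x + y) = \<tau> x + \<tau> y" and mult: "\<tau> (x * y) = \<tau> x * \<tau> y"
    if "x \<in> L" "y \<in> L" for x y
    using assms(2) that by (auto simp: field_auts_iff)
  show one: "\<tau> 1 = 1" and "inj_on \<tau> L" and "\<tau> ` L = L" "\<And>x. x \<in> L \<Longrightarrow> \<tau> x \<in> L"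
    using assms(2) by (auto simp: field_auts_iff bij_betw_def)
  show zero: "\<tau> 0 = 0" using add[of 0 0] K(1) by (metis add.right_neutral add_left_imp_eq)
  show "\<tau> (- x) = - \<tau> x" if "x \<in> L" for x
    using add[of x "- x"] zero K(5) that by (simp add: eq_neg_iff_add_eq_0 add.commute)
  show inv: "\<tau> (inverse x) = inverse (\<tau> x)" if "x \<in> L" for x
  proof (cases "x = 0")
    case False
    then have "\<tau> x * \<tau> (inverse x) = 1"
      using mult[OF that K(7)[OF that]] one by simp
    then show ?thesis by (simp add: inverse_unique)
  qed (simp add: zero)
  show "\<tau> (x / y) = \<tau> x / \<tau> y" if "x \<in> L" "y \<in> L" for x y
    using mult[OF that(1) K(7)[OF that(2)]] inv[OF that(2)] by (simp add: divide_inverse)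
  show "\<tau> (x ^ n) = \<tau> x ^ n" if "x \<in> L" for x n
    by (induction n) (auto simp: one mult that K(9))
  show "\<tau> (sum f I) = (\<Sum>i\<in>I. \<tau> (f i))" if "\<And>i. i \<in> I \<Longrightarrow> f i \<in> L" for f and I :: "'i set"
    using that by (induction I rule: infinite_finite_induct) (auto simp: zero add K(11))
  show "\<tau> (prod f I) = (\<Prod>i\<in>I. \<tau> (f i))" if "\<And>i. i \<in> I \<Longrightarrow> f i \<in> L" for f and I :: "'i set"
    using that by (induction I rule: infinite_finite_induct) (auto simp: one mult K(12))
qed

lemma field_aut_inv:
  assumes "ambient_subfield L" "\<tau> \<in> field_auts L"
  shows "inv_into L \<tau> \<in> field_auts L"
proof -
  have "ring (on_carrier L)"
    using field.axioms(1)[OF ring.subfield_iff(2)[OF _ assms(1)]] domain.axioms(1) cring.axioms(1)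
      cring.axioms(1)[OF cring_from_type_algebra] by blast
  from ring_iso_set_sym[OF this assms(2)] show ?thesis by simp
qed

lemma field_aut_eqI:
  assumes "ambient_subfield L" "\<tau> \<in> field_auts L" "\<rho> \<in> field_auts L"
    and "adjoin K A \<subseteq> L" "\<And>x. x \<in> K \<Longrightarrow> \<tau> x = \<rho> x" "\<And>x. x \<in> A \<Longrightarrow> \<tau> x = \<rho> x"
    and "x \<in> adjoin K A"
  shows "\<tau> x = \<rho> x"
  using assms(7)
proof (induction rule: adjoin_induct)
  case one then show ?case by (simp add: field_aut_simps(2)[OF assms(1)] assms(2,3))
qed (use assms(4-6) in \<open>auto simp: subset_iff field_aut_simps(6,7,8,9)[OF assms(1,2)] 
    field_aut_simps(6,7,8,9)[OF assms(1,3)]\<close>)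

section \<open>Galois groups as groups of bijections\<close>

lemma gal_group_carrier:
  "\<tau> \<in> carrier (gal_group L K) \<longleftrightarrow> \<tau> \<in> field_auts L \<and> \<tau> \<in> extensional L \<and> (\<forall>x\<in>K. \<tau> x = x)"
  by (auto simp: gal_group_def)

lemma gal_group_carrier_Bij: "\<tau> \<in> carrier (gal_group L K) \<Longrightarrow> \<tau> \<in> Bij L"
  by (auto simp: gal_group_carrier field_auts_iff Bij_def)

lemma gal_group_mult:
  assumes "\<tau> \<in> carrier (gal_group L K)" "\<rho> \<in> carrier (gal_group L K)"
  shows "\<tau> \<otimes>\<^bsub>gal_group L K\<^esub> \<rho> = compose L \<tau> \<rho>"
  using assms[THEN gal_group_carrier_Bij] by (simp add: gal_group_def BijGroup_def)

lemma gal_group_one: "\<one>\<^bsub>gal_group L K\<^esub> = (\<lambda>x\<in>L. x)"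
  by (simp add: gal_group_def BijGroup_def)

lemma gal_group_group:
  assumes L: "ambient_subfield L" and "K \<subseteq> L"
  shows "group (gal_group L K)"
proof -
  let ?C = "{\<tau> \<in> field_auts L \<inter> extensional L. \<forall>x \<in> K. \<tau> x = x}"
  have C: "?C = carrier (gal_group L K)" by (auto simp: gal_group_def)
  have sub: "subgroup ?C (BijGroup L)"
  proof (rule subgroup.intro)
    show "?C \<subseteq> carrier (BijGroup L)"
      using gal_group_carrier_Bij unfolding C by (auto simp: BijGroup_def)
  next
    fix \<tau> \<rho> assume *: "\<tau> \<in> ?C" "\<rho> \<in> ?C"
    then have "\<tau> \<otimes>\<^bsub>BijGroup L\<^esub> \<rho> = compose L \<tau> \<rho>"
      using gal_group_mult[of \<tau> L K \<rho>] unfolding C by (simp add: gal_group_def)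
    moreover have "compose L \<tau> \<rho> \<in> ?C"
    proof -
      have t: "\<tau> \<in> field_auts L" and r: "\<rho> \<in> field_auts L" using * by auto
      note t' = field_aut_simps[OF L t] and r' = field_aut_simps[OF L r] and c = subfield_closed[OF L]
      have "bij_betw (compose L \<tau> \<rho>) L L"
        using t r by (intro bij_betw_compose) (auto simp: field_auts_iff)
      then have "compose L \<tau> \<rho> \<in> field_auts L"
        by (auto simp: field_auts_iff compose_def t'(2,6,7) r'(2,5,6,7) c(2,3,4))
      moreover have "\<forall>x\<in>K. compose L \<tau> \<rho> x = x"
        using * \<open>K \<subseteq> L\<close> by (auto simp: compose_def)
      ultimately show ?thesis by simp
    qed
    ultimately show "\<tau> \<otimes>\<^bsub>BijGroup L\<^esub> \<rho> \<in> ?C" by simp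
  next
    show "\<one>\<^bsub>BijGroup L\<^esub> \<in> ?C"
      using \<open>K \<subseteq> L\<close> subfield_closed(2-4)[OF L]
      by (auto simp: BijGroup_def field_auts_iff bij_betw_def inj_on_def)
  next
    fix \<tau> assume *: "\<tau> \<in> ?C"
    \<comment> \<open>Group elements are extensional, so the inverse is \<open>inv_into\<close> cut
      down to \<open>L\<close>.\<close>
    then have "inv\<^bsub>BijGroup L\<^esub> \<tau> = (\<lambda>x\<in>L. inv_into L \<tau> x)"
      using gal_group_carrier_Bij[of \<tau> L K] unfolding C by (simp add: inv_BijGroup)
    moreover have "(\<lambda>x\<in>L. inv_into L \<tau> x) \<in> ?C"
    proof -
      have t: "\<tau> \<in> field_auts L" using * by auto
      note c = subfield_closed[OF L]
      have "(\<lambda>x\<in>L. inv_into L \<tau> x) \<in> field_auts L"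
        using field_aut_inv[OF L t] by (auto simp: field_auts_iff c(2,3,4))
      moreover have "inv_into L \<tau> x = x" if "x \<in> K" for x
        using inv_into_f_f[OF field_aut_simps(3)[OF L t], of x] that * \<open>K \<subseteq> L\<close> by auto
      ultimately show ?thesis using \<open>K \<subseteq> L\<close> by auto
    qed
    ultimately show "inv\<^bsub>BijGroup L\<^esub> \<tau> \<in> ?C" by simp
  qed
  show ?thesis
    using subgroup.subgroup_is_group[OF sub group_BijGroup] by (simp add: gal_group_def)
qed

section \<open>Roots of unity\<close>

text \<open>Cancelling the smaller power leaves a power of \<zeta> equal to 1 with exponent below
  \<open>p\<close>; minimality of \<open>p\<close> makes that exponent 0.\<close>

lemma primitive_root_pow_inj:
  assumes "primitive_root p \<zeta>" "p > 0" "i < p" "j < p" "\<zeta> ^ i = \<zeta> ^ j"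
  shows "i = j"
proof -
  have nz: "\<zeta> \<noteq> 0" using assms(1,2) by (auto simp: primitive_root_def power_0_left)
  have "i = j" if "i \<le> j" "j < p" "\<zeta> ^ i = \<zeta> ^ j" for i j
  proof -
    have "\<zeta> ^ i * \<zeta> ^ (j - i) = \<zeta> ^ i * 1"
      using that(1,3) le_add_diff_inverse[OF that(1)] by (metis mult.right_neutral power_add)
    then have "\<zeta> ^ (j - i) = 1" using nz by simp
    then show ?thesis using assms(1) that unfolding primitive_root_def by (cases "i = j") auto
  qed
  from this[of i j] this[of j i] show ?thesis using assms(3-5) by (cases "i \<le> j") auto
qed

lemma primitive_root_pow_mod:
  assumes "primitive_root p \<zeta>"
  shows "\<zeta> ^ (n mod p) = \<zeta> ^ n"
proof -
  have "\<zeta> ^ n = \<zeta> ^ (p * (n div p) + n mod p)" by simp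
  also have "\<dots> = \<zeta> ^ (n mod p)"
    using assms by (simp only: power_add power_mult primitive_root_def power_one mult_1_left)
  finally show ?thesis by simp
qed

lemma primitive_root_pow_eq_1_iff:
  assumes "primitive_root p \<zeta>" "p > 0"
  shows "\<zeta> ^ n = 1 \<longleftrightarrow> p dvd n"
  using primitive_root_pow_inj[OF assms, of "n mod p" 0] primitive_root_pow_mod[OF assms(1), of n] assms(2)
  by (auto simp: dvd_eq_mod_eq_0)

text \<open>Both sides are monic polynomials in \<open>y\<close> of degree \<open>p\<close> that
  vanish at the \<open>p\<close> distinct powers of \<zeta>. Their difference has degree below
  \<open>p\<close> and too many roots, so it is zero.\<close>

lemma pow_diff_one_factor:
  fixes \<zeta> y :: "'a::field"
  assumes "primitive_root p \<zeta>" "p > 0"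
  shows "y ^ p - 1 = (\<Prod>i<p. (y - \<zeta> ^ i))"
proof -
  define P :: "'a poly" where "P = monom 1 p - 1"
  define Q :: "'a poly" where "Q = (\<Prod>i<p. [:- (\<zeta> ^ i), 1:])"
  have degQ: "degree Q = p"
    by (simp add: Q_def degree_prod_sum_eq)
  have lcQ: "lead_coeff Q = 1"
    unfolding Q_def lead_coeff_prod by simp
  have lcP: "coeff P p = 1" using assms(2) by (simp add: P_def)
  have "P - Q = 0"
  proof (rule ccontr)
    assume nz: "P - Q \<noteq> 0"
    have "degree P \<le> p" unfolding P_def by (rule degree_diff_le) (simp_all add: degree_monom_le)
    then have le: "degree (P - Q) \<le> p" using degQ by (intro degree_diff_le) auto
    moreover have "degree (P - Q) \<noteq> p"
      using lcP lcQ degQ nz by (metis coeff_diff diff_self leading_coeff_0_iff)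
    ultimately have lt: "degree (P - Q) < p" by simp
    have "(\<lambda>i. \<zeta> ^ i) ` {..<p} \<subseteq> {x. poly (P - Q) x = 0}"
    proof clarsimp
      fix i assume "i < p"
      have "poly Q (\<zeta> ^ i) = 0" using \<open>i < p\<close> by (auto simp: Q_def poly_prod)
      moreover have "poly P (\<zeta> ^ i) = 0"
        using assms(1) power_mult[of \<zeta> p i] power_mult[of \<zeta> i p] mult.commute[of i p] by (simp add: P_def poly_monom primitive_root_def)
      ultimately show "poly P (\<zeta> ^ i) = poly Q (\<zeta> ^ i)" by simp
    qed
    then have "card ((\<lambda>i. \<zeta> ^ i) ` {..<p}) \<le> card {x. poly (P - Q) x = 0}"
      by (rule card_mono[OF poly_roots_finite[OF nz]])
    also have "card ((\<lambda>i. \<zeta> ^ i) ` {..<p}) = p"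
      by (subst card_image) (auto intro!: inj_onI primitive_root_pow_inj[OF assms])
    also have "card {x. poly (P - Q) x = 0} \<le> degree (P - Q)"
      by (rule card_poly_roots_bound[OF nz])
    finally show False using lt by simp
  qed
  then have "poly P y = poly Q y" by simp
  then show ?thesis by (simp add: P_def Q_def poly_monom poly_prod)
qed

lemma root_of_unity_cases:
  fixes \<zeta> z :: "'a::field"
  assumes "primitive_root p \<zeta>" "p > 0" "z ^ p = 1"
  obtains i where "i < p" "z = \<zeta> ^ i"
  using pow_diff_one_factor[OF assms(1,2), of z] assms(3) by (auto simp: prod_zero_iff)

section \<open>Duality and counting\<close>

text \<open>Duality over the field with \<open>p\<close> elements: a subspace killed only by the
  zero functional is the whole space. Vectors are integer functions read modulo \<open>p\<close>,
  and closure under differences already gives all integer multiples. The induction eliminates the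
  coordinate \<open>u\<close> and passes to the vectors of \<open>V\<close> that vanish there modulo
  \<open>p\<close>.\<close>

lemma annihilator_exists:
  fixes V :: "('i \<Rightarrow> int) set" and p :: nat
  assumes "finite T" "prime p"
    and "(\<lambda>_. 0) \<in> V" and diff: "\<And>f g. f \<in> V \<Longrightarrow> g \<in> V \<Longrightarrow> (\<lambda>v. f v - g v) \<in> V"
    and "\<And>c. (\<And>f. f \<in> V \<Longrightarrow> int p dvd (\<Sum>v\<in>T. c v * f v)) \<Longrightarrow> \<forall>v\<in>T. int p dvd c v"
  shows "\<exists>f\<in>V. \<forall>v\<in>T. [f v = t v] (mod int p)"
  using assms(1,3-)
proof (induction T arbitrary: V t rule: finite_induct)
  case empty
  then show ?case by auto
next
  case (insert u T)
  note diff = insert.prems(2) and ann = insert.prems(3)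
  have add: "(\<lambda>v. f v + g v) \<in> V" if "f \<in> V" "g \<in> V" for f g
    using diff[OF that(1) diff[OF insert.prems(1) that(2)]] by simp
  have scale_nat: "(\<lambda>v. int n * f v) \<in> V" if "f \<in> V" for f n
  proof (induction n)
    case 0 then show ?case using insert.prems(1) by simp
  next
    case (Suc n) then show ?case using add[OF that Suc] by (simp add: algebra_simps)
  qed
  have scale: "(\<lambda>v. n * f v) \<in> V" if "f \<in> V" for f n
  proof (cases n rule: int_cases2)
    case (nonneg k) then show ?thesis using scale_nat[OF that, of k] by simp
  next
    case (nonpos k) then show ?thesis
      using diff[OF insert.prems(1) scale_nat[OF that, of k]] by simp
  qed
  \<comment> \<open>Otherwise the functional that reads off the coordinate \<open>u\<close> would
    annihilate \<open>V\<close>.\<close>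
  obtain g where g: "g \<in> V" "\<not> int p dvd g u"
  proof (rule ccontr)
    assume "\<not> thesis"
    with that have *: "int p dvd f u" if "f \<in> V" for f using that by blast
    have "\<forall>v\<in>insert u T. int p dvd (if v = u then 1 else 0)"
      by (rule ann) (use * insert.hyps in \<open>auto simp: sum.delta' if_distrib[of "\<lambda>x. x * _"] cong: if_cong\<close>)
    then show False using \<open>prime p\<close> by auto
  qed
  have "coprime (g u) (int p)"
    using g(2) \<open>prime p\<close> by (metis coprime_commute prime_imp_coprime prime_nat_int_transfer)
  then obtain k where k: "[g u * k = 1] (mod int p)"
    using cong_solve_coprime_int by blast
  \<comment> \<open>The multiple of \<open>g\<close> whose coordinate at \<open>u\<close> is 1
    modulo \<open>p\<close>; subtracting \<open>f u * h\<close> projects \<open>V\<close> into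
    \<open>?W\<close>.\<close>
  define h where "h = (\<lambda>v. k * g v)"
  have h: "h \<in> V" "[h u = 1] (mod int p)"
    using scale[OF g(1)] k by (simp_all add: h_def mult.commute)
  let ?W = "{f \<in> V. int p dvd f u}"
  have red: "(\<lambda>v. f v - f u * h v) \<in> ?W" if "f \<in> V" for f
  proof -
    have "(\<lambda>v. f v - f u * h v) \<in> V"
      using diff[OF that scale[OF h(1), of "f u"]] by simp
    moreover have "int p dvd f u - f u * h u"
      using cong_scalar_left[OF h(2), of "f u"]
      by (simp add: cong_iff_dvd_diff dvd_diff_commute)
    ultimately show ?thesis by simp
  qed
  have annW: "\<forall>v\<in>T. int p dvd c v" if c: "\<And>f. f \<in> ?W \<Longrightarrow> int p dvd (\<Sum>v\<in>T. c v * f v)" for c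
  proof -
    \<comment> \<open>Extends the functional \<open>c\<close> to the coordinate \<open>u\<close> so
      that its value at \<open>f\<close> is that of \<open>c\<close> at the projection of
      \<open>f\<close>.\<close>
    define d where "d = c(u := - (\<Sum>v\<in>T. c v * h v))"
    have "\<forall>v\<in>insert u T. int p dvd d v"
    proof (rule ann)
      fix f assume "f \<in> V"
      have "(\<Sum>v\<in>insert u T. d v * f v) = d u * f u + (\<Sum>v\<in>T. d v * f v)"
        using insert.hyps by simp
      also have "(\<Sum>v\<in>T. d v * f v) = (\<Sum>v\<in>T. c v * f v)"
        using insert.hyps by (intro sum.cong) (auto simp: d_def)
      also have "d u * f u + \<dots> = (\<Sum>v\<in>T. c v * (f v - f u * h v))"
        by (simp add: d_def right_diff_distrib sum_subtractf sum_distrib_left mult_ac)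
      finally show "int p dvd (\<Sum>v\<in>insert u T. d v * f v)" using c[OF red[OF \<open>f \<in> V\<close>]] by simp
    qed
    then show ?thesis using insert.hyps by (auto simp: d_def split: if_splits)
  qed
  \<comment> \<open>The target is corrected in advance by \<open>t u * h\<close>, which is added
    back below to obtain the right value at \<open>u\<close>.\<close>
  have "\<exists>f\<in>?W. \<forall>v\<in>T. [f v = t v - t u * h v] (mod int p)"
    by (rule insert.IH) (use insert.prems(1) diff annW in auto)
  then obtain f where f: "f \<in> V" "int p dvd f u" "\<forall>v\<in>T. [f v = t v - t u * h v] (mod int p)"
    by auto
  have "(\<lambda>v. f v + t u * h v) \<in> V" by (rule add[OF f(1) scale[OF h(1)]])
  moreover have "[f u + t u * h u = 0 + t u * 1] (mod int p)"
    using f(2) h(2) by (intro cong_add cong_scalar_left) (auto simp: cong_0_iff)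
  moreover have "[f v + t u * h v = t v - t u * h v + t u * h v] (mod int p)" if "v \<in> T" for v
    using f(3) that by (intro cong_add) auto
  ultimately have "(\<lambda>v. f v + t u * h v) \<in> V \<and>
      (\<forall>v\<in>insert u T. [f v + t u * h v = t v] (mod int p))" by simp
  then show ?case by (intro bexI[of _ "\<lambda>v. f v + t u * h v"]) simp_all
qed

text \<open>The number of classes modulo \<open>N\<close> in \<open>G\<close> is at most \<open>|J|\<close> times that in \<open>G\<^sup>p\<close>, by the $p$-th
  power map, and at least \<open>|I|\<close> times that in \<open>D\<close>.\<close>

lemma pth_powers_mod_eqI:
  fixes G N D :: "'a::field set" and f :: "'i \<Rightarrow> 'a" and r :: "'a \<Rightarrow> 'b" and \<phi> :: "'a \<Rightarrow> 'c"
  assumes one: "1 \<in> G" "0 \<notin> G" and mult: "\<And>x y. x \<in> G \<Longrightarrow> y \<in> G \<Longrightarrow> x * y \<in> G"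
    and inv: "\<And>x. x \<in> G \<Longrightarrow> inverse x \<in> G"
    and N: "\<And>x y. x \<in> G \<Longrightarrow> y \<in> G \<Longrightarrow> r x = r y \<longleftrightarrow> x / y \<in> N"
    and fin: "finite (r ` G)"
    and D: "D \<subseteq> G" "\<And>x y. x \<in> D \<Longrightarrow> y \<in> D \<Longrightarrow> x / y \<in> D" "N \<subseteq> D" "\<And>x. x \<in> G \<Longrightarrow> x ^ p \<in> D"
    and I: "\<And>i. i \<in> I \<Longrightarrow> f i \<in> G" "\<And>i j. i \<in> I \<Longrightarrow> j \<in> I \<Longrightarrow> f i / f j \<in> D \<Longrightarrow> i = j"
    and tors: "\<And>x. x \<in> G \<Longrightarrow> x ^ p \<in> N \<Longrightarrow> \<phi> x \<in> J"
      "\<And>x y. x \<in> G \<Longrightarrow> x ^ p \<in> N \<Longrightarrow> y \<in> G \<Longrightarrow> y ^ p \<in> N \<Longrightarrow> \<phi> x = \<phi> y \<Longrightarrow> x / y \<in> N"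
    and J: "finite J" "card J \<le> card I" "I \<noteq> {}" "finite I"
    and d: "d \<in> D"
  obtains z where "z \<in> G" "d / z ^ p \<in> N"
proof -
  have div: "x / y \<in> G" if "x \<in> G" "y \<in> G" for x y
    using mult[OF that(1) inv[OF that(2)]] by (simp add: divide_inverse)
  have pow: "x ^ n \<in> G" if "x \<in> G" for x n
    by (induction n) (auto simp: one mult that)
  have nz: "x \<noteq> 0" if "x \<in> G" for x using that one by auto
  define P where "P = (\<lambda>z. z ^ p) ` G"
  have PG: "P \<subseteq> G" and PD: "P \<subseteq> D" using pow D(4) by (auto simp: P_def)
  have Dd: "x * y \<in> D" if "x \<in> D" "y \<in> D" for x y
  proof -
    have "1 / y \<in> D" using D(2)[of y y] D(2)[of 1 y] that nz D(1) by fastforce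
    from D(2)[OF that(1) this] show ?thesis by simp
  qed
  have fin': "finite (r ` A)" if "A \<subseteq> G" for A
    using finite_subset[OF image_mono[OF that] fin] .
  have "card (r ` D) * card I \<le> card (r ` G)"
  proof -
    define rep where "rep c = (SOME x. x \<in> D \<and> r x = c)" for c
    have rep: "rep c \<in> D \<and> r (rep c) = c" if "c \<in> r ` D" for c
      unfolding rep_def by (rule someI_ex) (use that in auto)
    \<comment> \<open>If two products have the same class, then the quotient of the two
      \<open>f i\<close> lies in \<open>D\<close>, which forces equal indices; the classes of the
      factors in \<open>D\<close> then agree as well.\<close>
    have "inj_on (\<lambda>(c, i). r (rep c * f i)) (r ` D \<times> I)"
    proof (rule inj_onI)
      fix u v assume "u \<in> r ` D \<times> I" "v \<in> r ` D \<times> I"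
        and *: "(\<lambda>(c, i). r (rep c * f i)) u = (\<lambda>(c, i). r (rep c * f i)) v"
      then obtain c i c' i' where c: "c \<in> r ` D" "c' \<in> r ` D" and i: "i \<in> I" "i' \<in> I"
        and uv: "u = (c, i)" "v = (c', i')" by blast
      have eq: "r (rep c * f i) = r (rep c' * f i')" using * by (simp add: uv)
      have repG: "rep c \<in> G" "rep c' \<in> G" using rep[OF c(1)] rep[OF c(2)] D(1) by auto
      have "(rep c * f i) / (rep c' * f i') \<in> N"
        using N[of "rep c * f i" "rep c' * f i'"] eq repG I(1) i mult by blast
      then have *: "(rep c / rep c') * (f i / f i') \<in> N" by (simp add: times_divide_times_eq)
      have "rep c / rep c' \<in> D" using D(2) rep c by auto
      then have "(rep c / rep c') * (f i / f i') / (rep c / rep c') \<in> D"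
        using D(2,3) * by blast
      then have "f i / f i' \<in> D" using nz[OF repG(1)] nz[OF repG(2)] by simp
      then have "i = i'" using I(2) i by blast
      then have "rep c / rep c' \<in> N" using * nz[OF I(1)[OF i(2)]] by simp
      then have "r (rep c) = r (rep c')" using N repG by blast
      then show "u = v" using rep c \<open>i = i'\<close> by (auto simp: uv)
    qed
    moreover have "(\<lambda>(c, i). r (rep c * f i)) ` (r ` D \<times> I) \<subseteq> r ` G"
    proof clarify
      fix c i assume "c \<in> D" "i \<in> I"
      then have "rep (r c) * f i \<in> G" using rep[of "r c"] D(1) I(1) mult by blast
      then show "r (rep (r c) * f i) \<in> r ` G" by simp
    qed
    ultimately have "card (r ` D \<times> I) \<le> card (r ` G)" using fin by (rule card_inj_on_le)
    then show ?thesis by (simp add: card_cartesian_product)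
  qed
  also have "card (r ` G) \<le> card (r ` P) * card J"
  proof -
    define s where "s c = (SOME x. x \<in> G \<and> r x = c)" for c
    have s: "s c \<in> G \<and> r (s c) = c" if "c \<in> r ` G" for c
      unfolding s_def by (rule someI_ex) (use that in auto)
    define t where "t b = (SOME x. x \<in> G \<and> r (x ^ p) = b)" for b
    have t: "t b \<in> G \<and> r (t b ^ p) = b" if "b \<in> r ` P" for b
      unfolding t_def by (rule someI_ex) (use that in \<open>auto simp: P_def\<close>)
    \<comment> \<open>A class \<open>c\<close> is recorded by the class \<open>b\<close> of its
      \<open>p\<close>-th power, together with the value of \<phi> at its quotient by a fixed
      solution \<open>t b\<close> for \<open>b\<close>. This quotient is \<open>p\<close>-torsion
      modulo \<open>N\<close>, where \<phi> separates classes.\<close>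
    define h where "h c = (let b = r (s c ^ p) in (b, \<phi> (s c / t b)))" for c
    have b: "r (s c ^ p) \<in> r ` P" if "c \<in> r ` G" for c using s[OF that] by (auto simp: P_def)
    have q: "s c / t (r (s c ^ p)) \<in> G" "(s c / t (r (s c ^ p))) ^ p \<in> N" if "c \<in> r ` G" for c
    proof -
      note * = s[OF that] t[OF b[OF that]]
      show "s c / t (r (s c ^ p)) \<in> G" using * div by blast
      have "s c ^ p / t (r (s c ^ p)) ^ p \<in> N" using N * pow by metis
      then show "(s c / t (r (s c ^ p))) ^ p \<in> N" by (simp add: power_divide)
    qed
    have "inj_on h (r ` G)"
    proof (rule inj_onI)
      fix c c' assume c: "c \<in> r ` G" "c' \<in> r ` G" and "h c = h c'"
      then have e: "r (s c ^ p) = r (s c' ^ p)"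
        "\<phi> (s c / t (r (s c ^ p))) = \<phi> (s c' / t (r (s c' ^ p)))"
        by (auto simp: h_def Let_def)
      let ?t = "t (r (s c' ^ p))"
      have "(s c / ?t) / (s c' / ?t) \<in> N"
        using tors(2)[OF q[OF c(1)] q[OF c(2)] e(2)] by (simp add: e(1))
      moreover have "?t \<noteq> 0" using t[OF b[OF c(2)]] nz by auto
      ultimately have "s c / s c' \<in> N" by simp
      then have "r (s c) = r (s c')" using N s c by blast
      then show "c = c'" using s c by auto
    qed
    moreover have "h ` (r ` G) \<subseteq> r ` P \<times> J"
      using b tors(1)[OF q] by (auto simp: h_def Let_def)
    ultimately have "card (r ` G) \<le> card (r ` P \<times> J)"
      by (rule card_inj_on_le) (simp add: J(1) fin'[OF PG])
    then show ?thesis by (simp add: card_cartesian_product)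
  qed
  also have "\<dots> \<le> card (r ` P) * card I" using J(2) by simp
  \<comment> \<open>Cancelling the positive factor \<open>card I\<close> bounds the classes of
    \<open>D\<close> by those of the \<open>p\<close>-th powers; as \<open>P\<close> lies in
    \<open>D\<close>, the two finite sets of classes coincide.\<close>
  finally have "card (r ` D) \<le> card (r ` P)" using J(3,4) by (simp add: card_gt_0_iff)
  moreover have "r ` P \<subseteq> r ` D" using PD by auto
  ultimately have "r ` P = r ` D" using card_subset_eq[OF fin'[OF D(1)]] card_mono[OF fin'[OF D(1)]]
    by (metis le_antisym)
  then have "r d \<in> r ` P" using d by simp
  then obtain z where "z \<in> G" "r d = r (z ^ p)" by (auto simp: P_def)
  then show ?thesis using that[of z] N[of d "z ^ p"] pow d D(1) by blast
qed

section \<open>Extension of automorphisms\<close>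

text \<open>Cut out of the polynomials over the ambient field, so that roots can be counted
  there.\<close>

definition polys_over :: "'a::field set \<Rightarrow> 'a poly set" where
  "polys_over M = {P. \<forall>i. coeff P i \<in> M}"

lemma polys_over_closed:
  assumes "ambient_subfield M"
  shows "0 \<in> polys_over M" "1 \<in> polys_over M"
    and "P \<in> polys_over M \<Longrightarrow> Q \<in> polys_over M \<Longrightarrow> P + Q \<in> polys_over M"
    and "P \<in> polys_over M \<Longrightarrow> Q \<in> polys_over M \<Longrightarrow> P - Q \<in> polys_over M"
    and "P \<in> polys_over M \<Longrightarrow> Q \<in> polys_over M \<Longrightarrow> P * Q \<in> polys_over M"
    and "P \<in> polys_over M \<Longrightarrow> - P \<in> polys_over M"
    and "c \<in> M \<Longrightarrow> monom c n \<in> polys_over M"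
  by (auto simp: polys_over_def coeff_mult coeff_1 intro!: subfield_closed[OF assms])

lemma poly_over_closed:
  assumes "ambient_subfield M" "ambient_subfield L" "M \<subseteq> L" "P \<in> polys_over M" "y \<in> L"
  shows "poly P y \<in> L"
  unfolding poly_altdef
  by (intro subfield_closed(4,9,11)[OF assms(2)])
    (use assms(3-5) in \<open>auto simp: polys_over_def\<close>)

context
  fixes M :: "'a::field set" and \<tau>
  assumes M: "ambient_subfield M" and \<tau>: "\<tau> \<in> field_auts M"
begin

private lemmas t = field_aut_simps[OF M \<tau>] and mc = subfield_closed[OF M]

lemma coeff_map_poly_aut: "coeff (map_poly \<tau> P) i = \<tau> (coeff P i)"
  by (simp add: coeff_map_poly t(1))

lemma map_poly_aut:
  "P \<in> polys_over M \<Longrightarrow> map_poly \<tau> P \<in> polys_over M"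
  "P \<in> polys_over M \<Longrightarrow> Q \<in> polys_over M \<Longrightarrow> map_poly \<tau> (P + Q) = map_poly \<tau> P + map_poly \<tau> Q"
  "P \<in> polys_over M \<Longrightarrow> map_poly \<tau> (- P) = - map_poly \<tau> P"
  "P \<in> polys_over M \<Longrightarrow> Q \<in> polys_over M \<Longrightarrow> map_poly \<tau> (P - Q) = map_poly \<tau> P - map_poly \<tau> Q"
  "P \<in> polys_over M \<Longrightarrow> Q \<in> polys_over M \<Longrightarrow> map_poly \<tau> (P * Q) = map_poly \<tau> P * map_poly \<tau> Q"
  "map_poly \<tau> (monom a n) = monom (\<tau> a) n"
proof -
  show add: "map_poly \<tau> (P + Q) = map_poly \<tau> P + map_poly \<tau> Q"
    if "P \<in> polys_over M" "Q \<in> polys_over M" for P Q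
    using that by (intro poly_eqI) (auto simp: polys_over_def coeff_map_poly_aut t(6))
  show minus: "map_poly \<tau> (- P) = - map_poly \<tau> P" if "P \<in> polys_over M" for P
    using that by (intro poly_eqI) (auto simp: polys_over_def coeff_map_poly_aut t(8))
  show "map_poly \<tau> (P - Q) = map_poly \<tau> P - map_poly \<tau> Q"
    if "P \<in> polys_over M" "Q \<in> polys_over M" for P Q
    using add[OF that(1) polys_over_closed(6)[OF M that(2)]] minus[OF that(2)] by simp
  show "map_poly \<tau> (P * Q) = map_poly \<tau> P * map_poly \<tau> Q"
    if "P \<in> polys_over M" "Q \<in> polys_over M" for P Q
  proof (rule poly_eqI)
    fix n
    have "\<tau> (\<Sum>i\<le>n. coeff P i * coeff Q (n - i)) = (\<Sum>i\<le>n. \<tau> (coeff P i * coeff Q (n - i)))"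
      using that mc(4) by (intro t(12)) (auto simp: polys_over_def)
    also have "\<dots> = (\<Sum>i\<le>n. \<tau> (coeff P i) * \<tau> (coeff Q (n - i)))"
      using that by (intro sum.cong refl t(7)) (auto simp: polys_over_def)
    finally show "coeff (map_poly \<tau> (P * Q)) n = coeff (map_poly \<tau> P * map_poly \<tau> Q) n"
      by (simp add: coeff_mult coeff_map_poly_aut)
  qed
  show "map_poly \<tau> (monom a n) = monom (\<tau> a) n"
    by (intro poly_eqI) (auto simp: coeff_map_poly_aut t(1))
qed (auto simp: polys_over_def coeff_map_poly_aut t(5))

end

text \<open>The conjugates \<open>\<zeta>\<^sup>i y\<close> are all roots of \<open>P\<close>, so that \<open>P\<close> is a multiple of \<open>X\<^sup>p - y\<^sup>p\<close>.\<close>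

lemma map_poly_aut_root:
  assumes M: "ambient_subfield M" and \<tau>: "\<tau> \<in> field_auts M"
    and L: "ambient_subfield L" "M \<subseteq> L" "y \<in> L" and \<sigma>: "\<sigma> \<in> field_auts L"
    and fixd: "\<And>m. m \<in> M \<Longrightarrow> \<sigma> m = m" and y: "\<sigma> y = \<zeta> * y" "y \<noteq> 0"
    and \<zeta>: "primitive_root p \<zeta>" "\<zeta> \<in> M" "p > 0"
    and a: "y ^ p \<in> M" "\<tau> (y ^ p) = y ^ p"
    and P: "P \<in> polys_over M" "poly P y = 0"
  shows "poly (map_poly \<tau> P) y = 0"
proof -
  note cM = subfield_closed[OF M] and cL = subfield_closed[OF L(1)] and s = field_aut_simps[OF L(1) \<sigma>]
  \<comment> \<open>\<sigma> fixes the coefficients and multiplies \<open>\<zeta> ^ i * y\<close> by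
    \<zeta>, so it carries each root to the next one.\<close>
  have conj: "poly Q (\<zeta> ^ i * y) = 0" if Q: "Q \<in> polys_over M" "poly Q y = 0" for Q i
  proof (induction i)
    case (Suc i)
    have z: "\<zeta> ^ i * y \<in> L" using \<zeta>(2) L(2,3) cL(4,9) by blast
    have Qc: "coeff Q k \<in> M" for k using Q(1) by (auto simp: polys_over_def)
    then have QL: "coeff Q k \<in> L" for k using L(2) by auto
    have "\<sigma> (\<zeta> ^ i * y) = \<zeta> ^ Suc i * y"
      using s(7)[of "\<zeta> ^ i" y] fixd[OF cM(9)[OF \<zeta>(2)], of i] cM(9)[OF \<zeta>(2), of i] L(2,3) y(1) by auto
    then have "poly Q (\<zeta> ^ Suc i * y) = (\<Sum>k\<le>degree Q. \<sigma> (coeff Q k) * \<sigma> ((\<zeta> ^ i * y) ^ k))"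
      by (simp add: poly_altdef fixd[OF Qc] s(11)[OF z])
    also have "\<dots> = (\<Sum>k\<le>degree Q. \<sigma> (coeff Q k * (\<zeta> ^ i * y) ^ k))"
      by (intro sum.cong refl s(7)[symmetric] QL cL(9) z)
    also have "\<dots> = \<sigma> (poly Q (\<zeta> ^ i * y))"
      unfolding poly_altdef by (intro s(12)[symmetric] cL(4) QL cL(9) z)
    finally show ?case using Suc s(1) by simp
  qed (use Q in simp)
  show ?thesis
    using P
  \<comment> \<open>Division by X^p - y^p as an induction on the degree: a remainder of degree below
    \<open>p\<close> with \<open>p\<close> distinct conjugate roots must be zero.\<close>
  proof (induction "degree P" arbitrary: P rule: less_induct)
    case less
    show ?case
    proof (cases "degree P < p")
      case True
      have "P = 0"
      proof (rule ccontr)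
        assume nz: "P \<noteq> 0"
        have "(\<lambda>i. \<zeta> ^ i * y) ` {..<p} \<subseteq> {x. poly P x = 0}" using conj[OF less.prems] by auto
        then have "card ((\<lambda>i. \<zeta> ^ i * y) ` {..<p}) \<le> card {x. poly P x = 0}"
          by (rule card_mono[OF poly_roots_finite[OF nz]])
        also have "card ((\<lambda>i. \<zeta> ^ i * y) ` {..<p}) = p"
          by (subst card_image)
            (use y(2) in \<open>auto intro!: inj_onI primitive_root_pow_inj[OF \<zeta>(1,3)]\<close>)
        finally show False using card_poly_roots_bound[OF nz] True by simp
      qed
      then show ?thesis by simp
    next
      case False
      define n where "n = degree P - p"
      have n: "degree P = p + n" using False by (simp add: n_def)
      define l where "l = lead_coeff P"
      have l: "l \<in> M" using less.prems(1) by (simp add: l_def polys_over_def)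
      \<comment> \<open>One step of long division: a multiple of X^p - y^p with the leading term of
        \<open>P\<close>.\<close>
      define R where "R = monom l n * (monom 1 p - monom (y ^ p) 0)"
      have D: "monom 1 p - monom (y ^ p) 0 \<in> polys_over M" "monom l n \<in> polys_over M"
        using polys_over_closed(4,7)[OF M] cM(2) a(1) l by auto
      then have R: "R \<in> polys_over M" by (simp add: R_def polys_over_closed(5)[OF M])
      have Ry: "poly R y = 0" by (simp add: R_def poly_monom)
      \<comment> \<open>\<tau> fixes the coefficients 1 and \<open>y ^ p\<close>, so the factor X^p
        - y^p is unchanged and still vanishes at \<open>y\<close>.\<close>
      have TR: "poly (map_poly \<tau> R) y = 0"
        using D cM(1,2) a polys_over_closed(7)[OF M]
        by (simp add: R_def map_poly_aut[OF M \<tau>] poly_monom field_aut_simps(2)[OF M \<tau>])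
      have "P - R \<in> polys_over M" "poly (P - R) y = 0"
        using polys_over_closed(4)[OF M less.prems(1) R] less.prems(2) Ry by auto
      moreover have "degree (P - R) < degree P \<or> P - R = 0"
      proof -
        have "R = monom l (degree P) - monom (l * y ^ p) n"
          by (simp add: R_def right_diff_distrib mult_monom n add.commute)
        then have "coeff (P - R) i = 0" if "i \<ge> degree P" for i
          using that n \<zeta>(3) by (cases "i = degree P") (auto simp: l_def coeff_eq_0)
        then show ?thesis
          by (metis leading_coeff_0_iff not_le)
      qed
      ultimately have "poly (map_poly \<tau> (P - R)) y = 0" using less.hyps by auto
      then show ?thesis using map_poly_aut(4)[OF M \<tau> less.prems(1) R] TR by simp
    qed
  qed
qed

text \<open>The extension sends P(y)/Q(y) to the quotient with \<tau> applied to the coefficients of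
  both polynomials. It is well defined because \<tau> preserves the property of vanishing at
  \<open>y\<close>; this is where \<sigma> enters, since it moves \<open>y\<close> to its conjugates
  over \<open>M\<close>.\<close>

lemma kummer_extend_aut:
  assumes M: "ambient_subfield M" and \<tau>: "\<tau> \<in> field_auts M"
    and L: "ambient_subfield L" "M \<subseteq> L" "y \<in> L" and \<sigma>: "\<sigma> \<in> field_auts L"
    and fixd: "\<And>m. m \<in> M \<Longrightarrow> \<sigma> m = m" and y: "\<sigma> y = \<zeta> * y" "y \<noteq> 0"
    and \<zeta>: "primitive_root p \<zeta>" "\<zeta> \<in> M" "p > 0"
    and a: "y ^ p \<in> M" "\<tau> (y ^ p) = y ^ p"
  obtains \<tau>' where "\<tau>' \<in> field_auts (adjoin M {y})" "\<forall>x\<in>M. \<tau>' x = \<tau> x" "\<tau>' y = y"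
proof -
  let ?T = "map_poly \<tau>" and ?M = "polys_over M" and ?A = "adjoin M {y}"
  define \<rho> where "\<rho> = inv_into M \<tau>"
  have \<rho>: "\<rho> \<in> field_auts M" unfolding \<rho>_def by (rule field_aut_inv[OF M \<tau>])
  note cM = subfield_closed[OF M] and pM = polys_over_closed[OF M] and T = map_poly_aut[OF M \<tau>]
    and t = field_aut_simps[OF M \<tau>] and cA = subfield_closed[OF adjoin_subfield[of M "{y}"]]
  have \<rho>\<tau>: "\<rho> (\<tau> x) = x" if "x \<in> M" for x
    using that t(3) by (simp add: \<rho>_def)
  have \<tau>\<rho>: "\<tau> (\<rho> x) = x" if "x \<in> M" for x
    using that t(4) by (simp add: \<rho>_def f_inv_into_f)
  \<comment> \<open>The converse direction is the same statement for the inverse automorphism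
    \<rho>.\<close>
  have root: "poly (?T P) y = 0 \<longleftrightarrow> poly P y = 0" if P: "P \<in> ?M" for P
  proof
    assume "poly (?T P) y = 0"
    then have "poly (map_poly \<rho> (?T P)) y = 0"
      using \<rho>\<tau>[OF a(1)] a(2) by (intro map_poly_aut_root[OF M \<rho> L \<sigma> fixd y \<zeta> a(1) _ T(1)[OF P]]) simp_all
    moreover have "map_poly \<rho> (?T P) = P"
      by (rule poly_eqI) (use P in \<open>simp add: coeff_map_poly_aut[OF M \<rho>] coeff_map_poly_aut[OF M \<tau>] \<rho>\<tau> polys_over_def\<close>)
    ultimately show "poly P y = 0" by simp
  qed (rule map_poly_aut_root[OF M \<tau> L \<sigma> fixd y \<zeta> a P])
  define rep where "rep x P Q \<longleftrightarrow> P \<in> ?M \<and> Q \<in> ?M \<and> poly Q y \<noteq> 0 \<and> x = poly P y / poly Q y" for x P Q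
  define img where "img P Q = poly (?T P) y / poly (?T Q) y" for P Q
  have rep_const: "rep x (monom x 0) 1" "img (monom x 0) 1 = \<tau> x" if "x \<in> M" for x
  proof -
    show "rep x (monom x 0) 1" using that by (simp add: rep_def pM poly_monom)
    have "?T 1 = 1" using T(6)[of 1 0] t(2) by simp
    then show "img (monom x 0) 1 = \<tau> x" by (simp add: img_def T(6) poly_monom)
  qed
  have rep_gen: "rep y (monom 1 1) 1" "img (monom 1 1) 1 = y"
  proof -
    show "rep y (monom 1 1) 1" by (simp add: rep_def pM cM poly_monom)
    have "?T 1 = 1" using T(6)[of 1 0] t(2) by simp
    then show "img (monom 1 1) 1 = y" by (simp add: img_def T(6) poly_monom t(2))
  qed
  have rep_mult: "rep (u * v) (P * P') (Q * Q')" "img (P * P') (Q * Q') = img P Q * img P' Q'"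
    if "rep u P Q" "rep v P' Q'" for u v P Q P' Q'
    using that by (auto simp: rep_def img_def pM(5) T(5))
  have rep_add: "rep (u + v) (P * Q' + P' * Q) (Q * Q')" "img (P * Q' + P' * Q) (Q * Q') = img P Q + img P' Q'"
    if "rep u P Q" "rep v P' Q'" for u v P Q P' Q'
    using that root[of Q] root[of Q'] by (auto simp: rep_def img_def pM T add_frac_eq)
  have rep_minus: "rep (- u) (- P) Q" if "rep u P Q" for u P Q
    using that by (auto simp: rep_def pM)
  have rep_inverse: "rep (inverse u) Q P" if "rep u P Q" "u \<noteq> 0" for u P Q
    using that by (auto simp: rep_def)
  have ex: "\<exists>P Q. rep x P Q" if "x \<in> ?A" for x
    using that
  proof (induction rule: adjoin_induct)
    case one show ?case using rep_const(1)[OF cM(2)] by (intro exI)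
  next
    case (base x) show ?case using rep_const(1)[OF base] by (intro exI)
  next
    case (gen x) then show ?case using rep_gen(1) by auto
  next
    case (minus x) then show ?case using rep_minus by metis
  next
    case (inverse x) then show ?case using rep_inverse by metis
  next
    case (add x y)
    then obtain P Q P' Q' where "rep x P Q" "rep y P' Q'" by blast
    from rep_add(1)[OF this]
    show ?case by (intro exI)
  next
    case (mult x y)
    then obtain P Q P' Q' where "rep x P Q" "rep y P' Q'" by blast
    from rep_mult(1)[OF this]
    show ?case by (intro exI)
  qed
  have A: "x \<in> ?A" if "rep x P Q" for x P Q
  proof -
    have "poly R y \<in> ?A" if "R \<in> ?M" for R
      by (rule poly_over_closed[OF M adjoin_subfield _ that]) (use adjoin_incl(1)[of M "{y}"] adjoin_incl(2)[of "{y}" M] in auto)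
    then show ?thesis using that cA(8) by (auto simp: rep_def)
  qed
  \<comment> \<open>The cross difference \<open>P * Q' - P' * Q\<close> vanishes at
    \<open>y\<close>, hence so does its image under \<tau>.\<close>
  have uniq: "img P Q = img P' Q'" if "rep x P Q" "rep x P' Q'" for x P Q P' Q'
  proof -
    have "P * Q' - P' * Q \<in> ?M" "poly (P * Q' - P' * Q) y = 0"
      using that by (auto simp: rep_def pM frac_eq_eq)
    then have "poly (?T (P * Q' - P' * Q)) y = 0" using root by blast
    then show ?thesis using that root[of Q] root[of Q']
      by (auto simp: rep_def img_def pM T frac_eq_eq)
  qed
  \<comment> \<open>The choice among representations is harmless by \<open>uniq\<close>.\<close>
  define \<tau>' where "\<tau>' x = (SOME z. \<exists>P Q. rep x P Q \<and> z = img P Q)" for x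
  have \<tau>': "\<tau>' x = img P Q" if "rep x P Q" for x P Q
    unfolding \<tau>'_def by (rule some_equality) (use that uniq in blast)+
  have hom: "\<tau>' (u + v) = \<tau>' u + \<tau>' v" "\<tau>' (u * v) = \<tau>' u * \<tau>' v" if uv: "u \<in> ?A" "v \<in> ?A" for u v
  proof -
    obtain P Q P' Q' where *: "rep u P Q" "rep v P' Q'" using ex[OF uv(1)] ex[OF uv(2)] by blast
    show "\<tau>' (u + v) = \<tau>' u + \<tau>' v" "\<tau>' (u * v) = \<tau>' u * \<tau>' v"
      using \<tau>'[OF *(1)] \<tau>'[OF *(2)] \<tau>'[OF rep_add(1)[OF *]] \<tau>'[OF rep_mult(1)[OF *]] rep_add(2)[OF *] rep_mult(2)[OF *]
      by auto
  qed
  have base: "\<tau>' x = \<tau> x" if "x \<in> M" for x using \<tau>'[OF rep_const(1)[OF that]] rep_const(2)[OF that] by simp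
  have gen': "\<tau>' y = y" using \<tau>'[OF rep_gen(1)] rep_gen(2) by simp
  have range: "\<tau>' x \<in> ?A" if x: "x \<in> ?A" for x
  proof -
    obtain P Q where "rep x P Q" using ex[OF x] by blast
    then have "rep (\<tau>' x) (?T P) (?T Q)" by (auto simp: \<tau>' rep_def img_def T(1) root)
    then show ?thesis by (rule A)
  qed
  have inj: "x = 0" if x: "x \<in> ?A" "\<tau>' x = 0" for x
  proof -
    obtain P Q where *: "rep x P Q" using ex[OF x(1)] by blast
    then show ?thesis using x(2) \<tau>'[OF *] root by (auto simp: rep_def img_def)
  qed
  \<comment> \<open>A preimage arises by applying \<rho> to the coefficients of a
    representation.\<close>
  have surj: "x \<in> \<tau>' ` ?A" if x: "x \<in> ?A" for x
  proof -
    obtain P Q where *: "rep x P Q" using ex[OF x] by blast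
    let ?P = "map_poly \<rho> P" and ?Q = "map_poly \<rho> Q"
    have PQ: "?P \<in> ?M" "?Q \<in> ?M" "?T ?P = P" "?T ?Q = Q"
      using * by (auto simp: rep_def field_aut_simps(5)[OF M \<rho>] polys_over_def \<tau>\<rho> 
          coeff_map_poly_aut[OF M \<rho>] coeff_map_poly_aut[OF M \<tau>] intro!: poly_eqI)
    then have r: "rep (poly ?P y / poly ?Q y) ?P ?Q"
      using * root[OF PQ(2)] by (auto simp: rep_def)
    have "\<tau>' (poly ?P y / poly ?Q y) = x" using \<tau>'[OF r] * by (simp add: img_def PQ rep_def)
    then show ?thesis using A[OF r] by (metis imageI)
  qed
  have "inj_on \<tau>' ?A"
  proof (rule inj_onI)
    fix u v assume uv: "u \<in> ?A" "v \<in> ?A" "\<tau>' u = \<tau>' v"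
    have d: "u - v \<in> ?A" using uv cA(6) by blast
    have "\<tau>' ((u - v) + v) = \<tau>' (u - v) + \<tau>' v" by (rule hom(1)[OF d uv(2)])
    then have "\<tau>' (u - v) = 0" using uv(3) by simp
    then show "u = v" using inj[OF d] by simp
  qed
  then have "\<tau>' \<in> field_auts ?A"
    using hom range surj base[OF cM(2)] t(2) by (auto simp: field_auts_iff bij_betw_def)
  then show thesis by (rule that) (simp_all add: base gen')
qed

section \<open>Residues\<close>

context
  fixes K :: "'a::field set" and v :: "'a \<Rightarrow> int"
  assumes K: "ambient_subfield K" and v: "v \<in> finite_places K"
begin

private lemmas c = subfield_closed[OF K]

lemma place_mult: "x \<in> K \<Longrightarrow> y \<in> K \<Longrightarrow> x \<noteq> 0 \<Longrightarrow> y \<noteq> 0 \<Longrightarrow> v (x * y) = v x + v y"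
  using v by (auto simp: finite_places_def)

lemma place_add:
  "x \<in> K \<Longrightarrow> y \<in> K \<Longrightarrow> x \<noteq> 0 \<Longrightarrow> y \<noteq> 0 \<Longrightarrow> x + y \<noteq> 0 \<Longrightarrow> min (v x) (v y) \<le> v (x + y)"
  using v by (auto simp: finite_places_def)

lemma place_one: "v 1 = 0"
  using place_mult[of 1 1] c(2) by simp

lemma place_power: "x \<in> K \<Longrightarrow> x \<noteq> 0 \<Longrightarrow> v (x ^ n) = int n * v x"
  by (induction n) (auto simp: place_one place_mult c(9) algebra_simps)

text \<open>\<open>x\<close> and \<open>- x\<close> have the same square, and doubling is injective
  on the integers.\<close>

lemma place_uminus:
  assumes "x \<in> K" "x \<noteq> 0"
  shows "v (- x) = v x"
proof -
  have "2 * v (- x) = v ((- x) ^ 2)" "2 * v x = v (x ^ 2)"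
    using place_power[of "- x" 2] place_power[of x 2] assms c(5) by auto
  then show ?thesis by simp
qed

lemma place_divide:
  assumes "x \<in> K" "y \<in> K" "x \<noteq> 0" "y \<noteq> 0"
  shows "v (x / y) = v x - v y"
  using place_mult[of "x / y" y] assms c(8) by auto

lemma valuation_ring_closed:
  "0 \<in> valuation_ring K v" "1 \<in> valuation_ring K v"
  "x \<in> valuation_ring K v \<Longrightarrow> y \<in> valuation_ring K v \<Longrightarrow> x + y \<in> valuation_ring K v"
  "x \<in> valuation_ring K v \<Longrightarrow> y \<in> valuation_ring K v \<Longrightarrow> x * y \<in> valuation_ring K v"
  "x \<in> valuation_ring K v \<Longrightarrow> - x \<in> valuation_ring K v"
proof -
  show "0 \<in> valuation_ring K v" "1 \<in> valuation_ring K v"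
    using c by (auto simp: valuation_ring_def place_one)
  show "x + y \<in> valuation_ring K v" if "x \<in> valuation_ring K v" "y \<in> valuation_ring K v"
    using that place_add[of x y] c(3) by (fastforce simp: valuation_ring_def)
  show "x * y \<in> valuation_ring K v" if "x \<in> valuation_ring K v" "y \<in> valuation_ring K v"
    using that place_mult[of x y] c(4) by (fastforce simp: valuation_ring_def)
  show "- x \<in> valuation_ring K v" if "x \<in> valuation_ring K v"
    using that place_uminus[of x] c(5) by (fastforce simp: valuation_ring_def)
qed

lemma valuation_ideal_closed:
  "0 \<in> valuation_ideal K v"
  "x \<in> valuation_ideal K v \<Longrightarrow> y \<in> valuation_ideal K v \<Longrightarrow> x + y \<in> valuation_ideal K v"
  "x \<in> valuation_ideal K v \<Longrightarrow> - x \<in> valuation_ideal K v"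
  "x \<in> valuation_ideal K v \<Longrightarrow> y \<in> valuation_ideal K v \<Longrightarrow> x - y \<in> valuation_ideal K v"
  "x \<in> valuation_ring K v \<Longrightarrow> y \<in> valuation_ideal K v \<Longrightarrow> x * y \<in> valuation_ideal K v"
  "x \<in> valuation_ideal K v \<Longrightarrow> x \<in> valuation_ring K v"
  "(\<And>i. i \<in> I \<Longrightarrow> f i \<in> valuation_ideal K v) \<Longrightarrow> sum f I \<in> valuation_ideal K v"
proof -
  show z: "0 \<in> valuation_ideal K v" using c by (auto simp: valuation_ideal_def)
  show add: "x + y \<in> valuation_ideal K v"
    if "x \<in> valuation_ideal K v" "y \<in> valuation_ideal K v" for x y
    using that place_add[of x y] c(3) by (fastforce simp: valuation_ideal_def)
  show minus: "- x \<in> valuation_ideal K v" if "x \<in> valuation_ideal K v" for x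
    using that place_uminus[of x] c(5) by (fastforce simp: valuation_ideal_def)
  show "x - y \<in> valuation_ideal K v" if "x \<in> valuation_ideal K v" "y \<in> valuation_ideal K v"
    using add[OF that(1) minus[OF that(2)]] by simp
  show "x * y \<in> valuation_ideal K v" if "x \<in> valuation_ring K v" "y \<in> valuation_ideal K v"
    using that place_mult[of x y] c(4) by (fastforce simp: valuation_ideal_def valuation_ring_def)
  show "x \<in> valuation_ideal K v \<Longrightarrow> x \<in> valuation_ring K v"
    by (auto simp: valuation_ideal_def valuation_ring_def)
  show "sum f I \<in> valuation_ideal K v" if "\<And>i. i \<in> I \<Longrightarrow> f i \<in> valuation_ideal K v"
    using that by (induction I rule: infinite_finite_induct) (auto simp: z add)
qed

lemma one_notin_valuation_ideal: "1 \<notin> valuation_ideal K v"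
  by (simp add: valuation_ideal_def place_one)

text \<open>Values of nonzero factors add up to the value of the product, so a positive total needs
  a positive summand. The factors may be any elements of \<open>K\<close>, integral or not.\<close>

lemma valuation_ideal_prod:
  assumes "finite I" "(\<Prod>i\<in>I. f i) \<in> valuation_ideal K v" "\<And>i. i \<in> I \<Longrightarrow> f i \<in> K"
  obtains i where "i \<in> I" "f i \<in> valuation_ideal K v"
  using assms
proof (induction I arbitrary: thesis rule: finite_induct)
  case empty
  then show ?case by (simp add: one_notin_valuation_ideal)
next
  case (insert j I)
  have P: "(\<Prod>i\<in>I. f i) \<in> K" using insert.prems(3) by (intro c(12)) auto
  have "f j \<in> valuation_ideal K v \<or> (\<Prod>i\<in>I. f i) \<in> valuation_ideal K v \<or>
      (f j \<noteq> 0 \<and> (\<Prod>i\<in>I. f i) \<noteq> 0 \<and> 0 < v (f j) + v (\<Prod>i\<in>I. f i))"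
    using insert.prems(2,3) insert.hyps P place_mult[of "f j" "\<Prod>i\<in>I. f i"] c(1)
    by (auto simp: valuation_ideal_def)
  then have "f j \<in> valuation_ideal K v \<or> (\<Prod>i\<in>I. f i) \<in> valuation_ideal K v"
    using insert.prems(3) P by (auto simp: valuation_ideal_def)
  then show ?case using insert by blast
qed

text \<open>The congruence makes \<open>x\<close> integral, and x^(n+1) - 1 = x^n (x - 1) + (x^n -
  1).\<close>

lemma power_cong_one:
  assumes "x - 1 \<in> valuation_ideal K v"
  shows "x ^ n - 1 \<in> valuation_ideal K v"
proof -
  have "x = 1 + (x - 1)" by simp
  then have x: "x \<in> valuation_ring K v"
    using valuation_ring_closed(2,3) valuation_ideal_closed(6)[OF assms] by metis
  have pow: "x ^ k \<in> valuation_ring K v" for k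
    by (induction k) (auto simp: valuation_ring_closed x)
  show ?thesis
  proof (induction n)
    case (Suc n)
    have "x ^ Suc n - 1 = x ^ n * (x - 1) + (x ^ n - 1)" by (simp add: algebra_simps)
    then show ?case using valuation_ideal_closed(2)[OF valuation_ideal_closed(5)[OF pow assms] Suc] by metis
  qed (simp add: valuation_ideal_closed(1))
qed

text \<open>\<open>y ^ p - 1\<close> is the product of the \<open>y - \<zeta> ^ i\<close>, and the
  valuation ideal is prime.\<close>

lemma root_of_unity_cong:
  assumes "primitive_root p \<zeta>" "p > 0" "\<zeta> \<in> K" "y \<in> K" "y ^ p - 1 \<in> valuation_ideal K v"
  obtains i where "i < p" "y - \<zeta> ^ i \<in> valuation_ideal K v"
proof -
  have "(\<Prod>i<p. (y - \<zeta> ^ i)) \<in> valuation_ideal K v"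
    using assms(5) pow_diff_one_factor[OF assms(1,2), of y] by simp
  then show thesis
    by (rule valuation_ideal_prod[rotated]) (use assms(3,4) that in \<open>auto intro: c(6,9)\<close>)
qed

text \<open>Distinct \<open>p\<close>-th roots of unity stay distinct modulo a place not above
  \<open>p\<close>: if \<xi> is not 1, the powers \<xi>^i with i < p sum to 0, yet each is congruent
  to 1, which puts \<open>p\<close> into the ideal.\<close>

lemma root_of_unity_cong_one:
  assumes "of_nat p \<notin> valuation_ideal K v" and \<xi>: "\<xi> ^ p = 1" "\<xi> - 1 \<in> valuation_ideal K v"
  shows "\<xi> = 1"
proof (rule ccontr)
  assume "\<xi> \<noteq> 1"
  have "(\<xi> - 1) * (\<Sum>i<p. \<xi> ^ i) = 0" using power_diff_1_eq[of \<xi> p] \<xi>(1) by simp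
  then have "(\<Sum>i<p. \<xi> ^ i) = 0" using \<open>\<xi> \<noteq> 1\<close> by simp
  then have "of_nat p = - (\<Sum>i<p. (\<xi> ^ i - 1))" by (simp add: sum_subtractf)
  also have "\<dots> \<in> valuation_ideal K v"
    by (intro valuation_ideal_closed(3,7) power_cong_one \<xi>(2))
  finally show False using assms(1) by simp
qed

section \<open>Residue classes and the residue field\<close>

lemma residue_class_eq_iff:
  "(\<lambda>i. i + x) ` valuation_ideal K v = (\<lambda>i. i + y) ` valuation_ideal K v
    \<longleftrightarrow> x - y \<in> valuation_ideal K v"
proof
  assume *: "(\<lambda>i. i + x) ` valuation_ideal K v = (\<lambda>i. i + y) ` valuation_ideal K v"
  have "x \<in> (\<lambda>i. i + x) ` valuation_ideal K v" using valuation_ideal_closed(1) by force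
  then show "x - y \<in> valuation_ideal K v" unfolding * by auto
next
  assume d: "x - y \<in> valuation_ideal K v"
  have "i + x = (i + (x - y)) + y" "i + y = (i - (x - y)) + x" for i by auto
  then show "(\<lambda>i. i + x) ` valuation_ideal K v = (\<lambda>i. i + y) ` valuation_ideal K v"
    using valuation_ideal_closed(2)[OF _ d] valuation_ideal_closed(4)[OF _ d] by (auto simp: image_iff; metis)
qed

lemma residue_field_carrier:
  "carrier (residue_field K v) = (\<lambda>x. (\<lambda>i. i + x) ` valuation_ideal K v) ` valuation_ring K v"
  by (auto simp: residue_field_def FactRing_def A_RCOSETS_def' a_r_coset_def' image_def)

text \<open>By Lagrange the order of the additive group of the residue field kills the class of 1.
  For an infinite residue field \<open>place_norm\<close> is 0, and the claim still holds.\<close>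

lemma residue_field_order:
  shows "of_nat (place_norm K v) \<in> valuation_ideal K v"
proof -
  let ?O = "on_carrier (valuation_ring K v)" and ?I = "valuation_ideal K v" and ?R = "residue_field K v"
  interpret type: cring "ring_of_type_algebra :: 'a ring" by (rule cring_from_type_algebra)
  have "ring ?O"
    by (intro type.subring_is_ring type.subringI) (auto simp: valuation_ring_closed)
  then interpret ring ?O .
  interpret ideal ?I ?O
  proof (rule idealI[OF \<open>ring ?O\<close>])
    show "subgroup ?I (add_monoid ?O)"
    proof (rule add.subgroupI)
      show "\<ominus>\<^bsub>?O\<^esub> x \<in> ?I" if "x \<in> ?I" for x
      proof -
        have "\<ominus>\<^bsub>?O\<^esub> x = - x"
          using that valuation_ideal_closed valuation_ring_closed by (intro minus_equality) auto
        then show ?thesis using valuation_ideal_closed(3)[OF that] by simp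
      qed
    qed (use valuation_ideal_closed in auto)
    show "x \<otimes>\<^bsub>?O\<^esub> a \<in> ?I" "a \<otimes>\<^bsub>?O\<^esub> x \<in> ?I" if "a \<in> ?I" "x \<in> carrier ?O" for a x
      using valuation_ideal_closed(5)[of x a] that by (simp_all add: mult.commute)
  qed
  interpret R: ring ?R unfolding residue_field_def by (rule quotient_is_ring)
  define h where "h x = ?I +>\<^bsub>?O\<^esub> x" for x
  have h: "h \<in> ring_hom ?O ?R" using rcos_ring_hom by (simp add: h_def[abs_def] residue_field_def)
  have n: "of_nat n \<in> valuation_ring K v" for n
    by (induction n) (auto simp: valuation_ring_closed)
  have "h (of_nat n) = [n] \<cdot>\<^bsub>?R\<^esub> h 1" for n
  proof (induction n)
    case 0 then show ?case using ring_hom_zero[OF h \<open>ring ?O\<close> R.ring_axioms] by simp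
  next
    case (Suc n)
    have "h (of_nat n + 1) = h (of_nat n) \<oplus>\<^bsub>?R\<^esub> h 1"
      using ring_hom_add[OF h, of "of_nat n" 1] n valuation_ring_closed(2) by simp
    then show ?case using Suc by (simp add: add.commute)
  qed
  moreover have "[place_norm K v] \<cdot>\<^bsub>?R\<^esub> h 1 = \<zero>\<^bsub>?R\<^esub>"
    using group.pow_order_eq_1[OF R.add.is_group, of "h 1"] ring_hom_closed[OF h, of 1] valuation_ring_closed(2)
    by (simp add: place_norm_def Coset.order_def add_pow_def)
  ultimately have "h (of_nat (place_norm K v)) = ?I"
    by (simp add: residue_field_def FactRing_def)
  moreover have "of_nat (place_norm K v) \<in> h (of_nat (place_norm K v))"
    using valuation_ideal_closed(1) by (force simp: h_def a_r_coset_def')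
  ultimately show ?thesis by simp
qed

text \<open>An infinite carrier would have cardinality 0, which is not 1 modulo \<open>p\<close>. If
  \<open>p\<close> were in the ideal, then so would be 1, as the difference of the norm and a
  multiple of \<open>p\<close>.\<close>

lemma place_norm_cong_one:
  assumes "prime p" "[place_norm K v = 1] (mod p)"
  shows "finite (carrier (residue_field K v))" "of_nat p \<notin> valuation_ideal K v"
proof -
  have p: "p > 1" using assms(1) prime_gt_1_nat by blast
  show fin: "finite (carrier (residue_field K v))"
  proof (rule ccontr)
    assume "infinite (carrier (residue_field K v))"
    then have "place_norm K v = 0" by (simp add: place_norm_def)
    then show False using assms(2) p by (simp add: cong_def)
  qed
  show "of_nat p \<notin> valuation_ideal K v"
  proof
    assume *: "of_nat p \<in> valuation_ideal K v"
    have "place_norm K v = (place_norm K v div p) * p + 1"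
      using assms(2) p div_mult_mod_eq[of "place_norm K v" p] by (simp add: cong_def)
    then have "of_nat (place_norm K v) = of_nat (place_norm K v div p) * of_nat p + (1 :: 'a)"
      by (metis of_nat_1 of_nat_add of_nat_mult)
    then have "1 = of_nat (place_norm K v) - of_nat (place_norm K v div p) * (of_nat p :: 'a)" by simp
    moreover have "of_nat n \<in> valuation_ring K v" for n
      by (induction n) (auto simp: valuation_ring_closed)
    ultimately have "1 \<in> valuation_ideal K v"
      using valuation_ideal_closed(4,5) residue_field_order * by metis
    then show False using one_notin_valuation_ideal by simp
  qed
qed

end

section \<open>Real places, and places lying over one another\<close>

lemma real_place_simps:
  assumes "ambient_subfield K" "v \<in> real_places K"
  shows "v 1 = 1" "x \<in> K \<Longrightarrow> y \<in> K \<Longrightarrow> v (x * y) = v x * v y"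
    and "x \<in> K \<Longrightarrow> x \<noteq> 0 \<Longrightarrow> v (inverse x) = inverse (v x)"
proof -
  show one: "v 1 = 1" and mult: "x \<in> K \<Longrightarrow> y \<in> K \<Longrightarrow> v (x * y) = v x * v y" for x y
    using assms(2) by (auto simp: real_places_def ring_hom_def)
  assume "x \<in> K" "x \<noteq> 0"
  then have "v x * v (inverse x) = 1"
    using mult[of x "inverse x"] subfield_closed(7)[OF assms(1)] one by simp
  then show "v (inverse x) = inverse (v x)" by (simp add: inverse_unique)
qed

lemma lies_over_trans:
  assumes "K \<subseteq> K'" "lies_over K' W w" "lies_over K w v"
  shows "lies_over K W v"
proof -
  obtain e f where "e > 0" "\<forall>x\<in>K' - {0}. W x = e * w x" "f > 0" "\<forall>x\<in>K - {0}. w x = f * v x"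
    using assms(2,3) by (auto simp: lies_over_def)
  then show ?thesis
    using assms(1) unfolding lies_over_def by (intro exI[of _ "e * f"]) (auto simp: subset_iff)
qed

text \<open>The ramification index is positive, so it keeps the sign of the value. This moves
  congruences between elements of \<open>K\<close> up to \<open>L\<close> and back.\<close>

lemma lies_over_valuation_ideal:
  assumes "K \<subseteq> L" "lies_over K W v" "x \<in> K"
  shows "x \<in> valuation_ideal L W \<longleftrightarrow> x \<in> valuation_ideal K v"
proof (cases "x = 0")
  case False
  obtain e where "e > 0" "\<forall>x\<in>K - {0}. W x = e * v x"
    using assms(2) by (auto simp: lies_over_def)
  then show ?thesis using False assms(1,3) by (auto simp: valuation_ideal_def zero_less_mult_iff)
qed (use assms in \<open>auto simp: valuation_ideal_def\<close>)

section \<open>Kummer extensions\<close>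

locale kummer =
  fixes p :: nat and \<zeta> :: "'a::{alg_closed_field, field_char_0}" and K :: "'a set"
  assumes prime_p: "prime p" and K: "ambient_subfield K" and \<zeta>: "primitive_root p \<zeta>"
begin

abbreviation K' where "K' \<equiv> adjoin K {\<zeta>}"
abbreviation pth_roots where "pth_roots B \<equiv> {y. y ^ p \<in> B}"

lemma p_pos: "p > 0" using prime_p prime_gt_0_nat by blast
lemma zeta_nz: "\<zeta> \<noteq> 0" using \<zeta> p_pos by (auto simp: primitive_root_def power_0_left)
lemma zeta_power_p: "\<zeta> ^ p = 1" using \<zeta> by (simp add: primitive_root_def)

lemma K'_props: "ambient_subfield K'" "K \<subseteq> K'" "\<zeta> \<in> K'"
  using adjoin_subfield[of K "{\<zeta>}"] adjoin_incl(1)[of K "{\<zeta>}"] adjoin_incl(2)[of "{\<zeta>}" K] by auto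

text \<open>Integer exponents are needed because the duality argument works with integer vectors
  modulo \<open>p\<close>.\<close>

lemma zeta_powi_eq_1_iff: "\<zeta> powi n = 1 \<longleftrightarrow> int p dvd n"
proof -
  have "\<zeta> powi n = \<zeta> powi (int p * (n div int p) + n mod int p)" by simp
  also have "\<dots> = (\<zeta> powi int p) powi (n div int p) * \<zeta> powi (n mod int p)"
    using zeta_nz by (subst power_int_add) (simp_all add: power_int_mult)
  also have "\<zeta> powi int p = 1" by (simp add: zeta_power_p)
  finally have "\<zeta> powi n = \<zeta> ^ nat (n mod int p)" using p_pos by (simp add: power_int_def)
  then have "\<zeta> powi n = 1 \<longleftrightarrow> p dvd nat (n mod int p)"
    by (simp add: primitive_root_pow_eq_1_iff[OF \<zeta> p_pos])
  also have "\<dots> \<longleftrightarrow> int p dvd n mod int p" using p_pos by (simp add: int_dvd_int_iff flip: int_dvd_int_iff)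
  finally show ?thesis by (simp add: dvd_mod_iff)
qed

lemma zeta_powi_cong: "[m = n] (mod int p) \<Longrightarrow> \<zeta> powi m = \<zeta> powi n"
proof -
  assume "[m = n] (mod int p)"
  then have "\<zeta> powi (m - n) = 1" by (simp add: zeta_powi_eq_1_iff cong_iff_dvd_diff)
  then show ?thesis using zeta_nz by (simp add: power_int_diff)
qed

lemma root_quotient:
  assumes "x ^ p = y ^ p" "y \<noteq> 0"
  obtains i where "i < p" "x = \<zeta> ^ i * y"
proof -
  have "(x / y) ^ p = 1" using assms by (simp add: power_divide)
  then obtain i where "i < p" "x / y = \<zeta> ^ i" by (rule root_of_unity_cases[OF \<zeta> p_pos])
  then show thesis using that[of i] assms(2) by (simp add: field_simps)
qed

lemma pth_root_exists: obtains y where "y ^ p = (x :: 'a)"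
  using nth_root_exists[OF p_pos] by blast

section \<open>Galois groups of fields generated by \<open>p\<close>-th roots\<close>

context
  fixes B :: "'a set"
  assumes B: "B \<subseteq> K - {0}"
begin

abbreviation (input) L where "L \<equiv> adjoin K' (pth_roots B)"
abbreviation (input) G where "G \<equiv> gal_group L K'"

lemma L_props: "ambient_subfield L" "K' \<subseteq> L" "pth_roots B \<subseteq> L" "\<zeta> ^ i \<in> L" "K \<subseteq> L"
  using adjoin_subfield adjoin_incl[of K' "pth_roots B"] adjoin_incl[of "pth_roots B" K'] K'_props
    subfield_closed(9)[OF K'_props(1,3)] by blast+

lemma root_nz: "y \<in> pth_roots B \<Longrightarrow> y \<noteq> 0"
  using B p_pos by (auto simp: power_0_left)

lemma gal_autD:
  assumes "\<tau> \<in> carrier G"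
  shows "\<tau> \<in> field_auts L" "\<tau> \<in> extensional L" "\<And>x. x \<in> K' \<Longrightarrow> \<tau> x = x"
    "\<tau> (\<zeta> ^ i) = \<zeta> ^ i" "\<And>x. x \<in> L \<Longrightarrow> \<tau> (\<zeta> ^ i * x) = \<zeta> ^ i * \<tau> x"
proof -
  show 1: "\<tau> \<in> field_auts L" "\<tau> \<in> extensional L" "\<And>x. x \<in> K' \<Longrightarrow> \<tau> x = x"
    using assms by (auto simp: gal_group_carrier)
  show 2: "\<tau> (\<zeta> ^ i) = \<zeta> ^ i" by (rule 1(3)[OF subfield_closed(9)[OF K'_props(1,3)]])
  show "\<tau> (\<zeta> ^ i * x) = \<zeta> ^ i * \<tau> x" if "x \<in> L" for x
    using field_aut_simps(7)[OF L_props(1) 1(1) L_props(4) that, of i] 2 by simp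
qed

text \<open>\<tau> fixes \<open>y ^ p\<close>, which lies in \<open>K\<close>, so
  \<open>\<tau> y\<close> is another root of the same element.\<close>

lemma gal_root:
  assumes "\<tau> \<in> carrier G" "y \<in> pth_roots B"
  obtains i where "i < p" "\<tau> y = \<zeta> ^ i * y"
proof -
  have "\<tau> y ^ p = \<tau> (y ^ p)"
    using field_aut_simps(11)[OF L_props(1) gal_autD(1)[OF assms(1)]] assms(2) L_props(3) by auto
  also have "\<dots> = y ^ p" using gal_autD(3)[OF assms(1), of "y ^ p"] assms(2) B K'_props(2) by auto
  finally show thesis using root_nz[OF assms(2)] by (rule root_quotient) (rule that)
qed

lemma gal_eqI:
  assumes "\<tau> \<in> carrier G" "\<rho> \<in> carrier G" "\<And>y. y \<in> pth_roots B \<Longrightarrow> \<tau> y = \<rho> y"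
  shows "\<tau> = \<rho>"
proof (rule extensionalityI[OF gal_autD(2)[OF assms(1)] gal_autD(2)[OF assms(2)]])
  fix x assume "x \<in> L"
  show "\<tau> x = \<rho> x"
    by (rule field_aut_eqI[OF L_props(1) gal_autD(1)[OF assms(1)] gal_autD(1)[OF assms(2)] subset_refl
          _ assms(3) \<open>x \<in> L\<close>])
      (simp add: gal_autD(3)[OF assms(1)] gal_autD(3)[OF assms(2)])
qed

text \<open>Automorphisms in \<open>G\<close> fix the roots of unity, so the exponent at
  \<open>y\<close> is additive in the automorphism.\<close>

lemma gal_mult_root:
  assumes "\<tau> \<in> carrier G" "\<rho> \<in> carrier G" "y \<in> L"
    and "\<tau> y = \<zeta> ^ i * y" "\<rho> y = \<zeta> ^ j * y"
  shows "(\<tau> \<otimes>\<^bsub>G\<^esub> \<rho>) y = \<zeta> ^ (i + j) * y"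
  using gal_autD(5)[OF assms(1,3), of j] assms(3-5)
  by (simp add: gal_group_mult[OF assms(1,2)] compose_eq power_add)

text \<open>Automorphisms are determined by their exponents at the \<open>p\<close>-th roots, and
  these add.\<close>

lemma gal_comm_group: "comm_group G"
proof (rule group.group_comm_groupI)
  show "group G" by (rule gal_group_group[OF L_props(1,2)])
  then interpret group G .
  fix \<tau> \<rho> assume *: "\<tau> \<in> carrier G" "\<rho> \<in> carrier G"
  show "\<tau> \<otimes>\<^bsub>G\<^esub> \<rho> = \<rho> \<otimes>\<^bsub>G\<^esub> \<tau>"
  proof (rule gal_eqI)
    fix y assume y: "y \<in> pth_roots B"
    have L: "y \<in> L" using y L_props(3) by blast
    obtain i where i: "\<tau> y = \<zeta> ^ i * y" by (rule gal_root[OF *(1) y])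
    obtain j where j: "\<rho> y = \<zeta> ^ j * y" by (rule gal_root[OF *(2) y])
    show "(\<tau> \<otimes>\<^bsub>G\<^esub> \<rho>) y = (\<rho> \<otimes>\<^bsub>G\<^esub> \<tau>) y"
      using gal_mult_root[OF * L i j] gal_mult_root[OF *(2,1) L j i] by (simp add: add.commute)
  qed (use * in auto)
qed

lemma fp_lincomb_closed:
  "(\<And>i. i \<in> I \<Longrightarrow> \<tau> i \<in> carrier G) \<Longrightarrow> fp_lincomb G \<tau> I c \<in> carrier G"
proof -
  interpret comm_group G by (rule gal_comm_group)
  show "(\<And>i. i \<in> I \<Longrightarrow> \<tau> i \<in> carrier G) \<Longrightarrow> fp_lincomb G \<tau> I c \<in> carrier G"
    unfolding fp_lincomb_def by (rule finprod_closed) auto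
qed

text \<open>The exponent at \<open>y\<close> is linear in the automorphism; this translates linear
  combinations in the Galois group into sums of exponents.\<close>

lemma fp_lincomb_root:
  assumes "finite I" "\<And>i. i \<in> I \<Longrightarrow> \<tau> i \<in> carrier G" "y \<in> L" "\<And>i. i \<in> I \<Longrightarrow> \<tau> i y = \<zeta> ^ l i * y"
  shows "fp_lincomb G \<tau> I c y = \<zeta> ^ (\<Sum>i\<in>I. c i * l i) * y"
proof -
  interpret comm_group G by (rule gal_comm_group)
  have pow: "(\<tau> i [^]\<^bsub>G\<^esub> n) y = \<zeta> ^ (n * l i) * y" if "i \<in> I" for i and n :: nat
  proof (induction n)
    case 0 then show ?case using assms(3) by (simp add: gal_group_one)
  next
    case (Suc n)
    have "(\<tau> i [^]\<^bsub>G\<^esub> n \<otimes>\<^bsub>G\<^esub> \<tau> i) y = \<zeta> ^ (n * l i + l i) * y"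
      using assms(2)[OF that] by (intro gal_mult_root assms(3) Suc assms(4)[OF that]) auto
    then show ?case by (simp add: add.commute)
  qed
  show ?thesis
    using assms(1,2) pow unfolding fp_lincomb_def
  proof (induction I rule: finite_induct)
    case empty then show ?case using assms(3) by (simp add: gal_group_one)
  next
    case (insert j I)
    have "finprod G (\<lambda>i. \<tau> i [^]\<^bsub>G\<^esub> c i) (insert j I)
        = \<tau> j [^]\<^bsub>G\<^esub> c j \<otimes>\<^bsub>G\<^esub> finprod G (\<lambda>i. \<tau> i [^]\<^bsub>G\<^esub> c i) I"
      by (rule finprod_insert) (use insert in auto)
    moreover have "finprod G (\<lambda>i. \<tau> i [^]\<^bsub>G\<^esub> c i) I \<in> carrier G"
      by (rule finprod_closed) (use insert in auto)
    ultimately show ?case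
      using gal_mult_root[of "\<tau> j [^]\<^bsub>G\<^esub> c j" "finprod G (\<lambda>i. \<tau> i [^]\<^bsub>G\<^esub> c i) I" y, OF _ _ assms(3)]
        insert by simp
  qed
qed

end

text \<open>The smaller field is stable under every automorphism of the larger one, because each
  generating root is only multiplied by a root of unity.\<close>

lemma gal_restrict:
  assumes "B \<subseteq> B'" "B' \<subseteq> K - {0}" "\<tau> \<in> carrier (gal_group (adjoin K' (pth_roots B')) K')"
  shows "restrict \<tau> (adjoin K' (pth_roots B)) \<in> carrier (gal_group (adjoin K' (pth_roots B)) K')"
proof -
  let ?L = "adjoin K' (pth_roots B)" and ?L' = "adjoin K' (pth_roots B')"
  have B: "B \<subseteq> K - {0}" using assms by auto
  note L = L_props[OF B] and L' = L_props[OF assms(2)]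
  have sub: "?L \<subseteq> ?L'" by (rule adjoin_mono) (use assms(1) in auto)
  note cL = subfield_closed[OF L(1)]
  have into: "\<rho> x \<in> ?L" if \<rho>: "\<rho> \<in> carrier (gal_group ?L' K')" and "x \<in> ?L" for \<rho> x
    using that(2)
  proof (induction rule: adjoin_induct)
    case (gen y)
    then have "y \<in> pth_roots B'" using assms(1) by auto
    then obtain i where "\<rho> y = \<zeta> ^ i * y" by (rule gal_root[OF assms(2) \<rho>])
    then show ?case using cL(4) L(3,4) gen by auto
  qed (use sub L(2) gal_autD(3)[OF assms(2) \<rho>] cL in
      \<open>auto simp: subset_iff field_aut_simps[OF L'(1) gal_autD(1)[OF assms(2) \<rho>]]\<close>)
  note \<tau> = gal_autD[OF assms(2,3)]
  note t = field_aut_simps[OF L'(1) \<tau>(1)]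
  \<comment> \<open>Stability under the inverse automorphism makes the restriction of \<tau>
    surjective.\<close>
  let ?\<rho> = "restrict (inv_into ?L' \<tau>) ?L'"
  interpret group "gal_group ?L' K'" by (rule gal_group_group[OF L'(1,2)])
  have \<rho>: "?\<rho> \<in> carrier (gal_group ?L' K')"
  proof -
    have "?\<rho> \<in> field_auts ?L'"
      using field_aut_inv[OF L'(1) \<tau>(1)] subfield_closed[OF L'(1)] by (auto simp: field_auts_iff)
    moreover have "inv_into ?L' \<tau> x = x" if "x \<in> K'" for x
      using inv_into_f_f[OF t(3), of x] \<tau>(3)[OF that] that L'(2) by auto
    ultimately show ?thesis using L'(2) by (auto simp: gal_group_carrier)
  qed
  have "\<tau> ` ?L = ?L"
  proof
    show "?L \<subseteq> \<tau> ` ?L"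
    proof
      fix x assume x: "x \<in> ?L"
      then have "?\<rho> x \<in> ?L" using into[OF \<rho>] by blast
      moreover have "\<tau> (?\<rho> x) = x" using x sub t(4) by (auto simp: f_inv_into_f)
      ultimately show "x \<in> \<tau> ` ?L" by (metis imageI)
    qed
  qed (use into[OF assms(3)] in auto)
  then have "bij_betw (restrict \<tau> ?L) ?L ?L"
    using inj_on_subset[OF t(3) sub] by (simp add: bij_betw_def)
  then have "restrict \<tau> ?L \<in> field_auts ?L"
    using sub t(2,6,7) cL by (auto simp: field_auts_iff subset_iff)
  then show ?thesis using L(2) \<tau>(3) by (auto simp: gal_group_carrier)
qed

lemma gal_restrict_hom:
  assumes "B \<subseteq> B'" "B' \<subseteq> K - {0}"
  shows "(\<lambda>\<tau>. restrict \<tau> (adjoin K' (pth_roots B)))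
    \<in> hom (gal_group (adjoin K' (pth_roots B')) K') (gal_group (adjoin K' (pth_roots B)) K')"
proof (rule homI)
  let ?L = "adjoin K' (pth_roots B)" and ?L' = "adjoin K' (pth_roots B')"
  show "restrict \<tau> ?L \<in> carrier (gal_group ?L K')" if "\<tau> \<in> carrier (gal_group ?L' K')" for \<tau>
    by (rule gal_restrict[OF assms that])
  fix \<tau> \<rho> assume *: "\<tau> \<in> carrier (gal_group ?L' K')" "\<rho> \<in> carrier (gal_group ?L' K')"
  have B: "B \<subseteq> K - {0}" using assms by auto
  have sub: "?L \<subseteq> ?L'"
    by (rule adjoin_mono) (use assms(1) in auto)
  have "\<rho> x \<in> ?L" if "x \<in> ?L" for x
    using field_aut_simps(5)[OF L_props(1)[OF B] gal_autD(1)[OF B gal_restrict[OF assms *(2)]] that] that by simp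
  then show "restrict (\<tau> \<otimes>\<^bsub>gal_group ?L' K'\<^esub> \<rho>) ?L
      = restrict \<tau> ?L \<otimes>\<^bsub>gal_group ?L K'\<^esub> restrict \<rho> ?L"
    using sub unfolding gal_group_mult[OF *]
      gal_group_mult[OF gal_restrict[OF assms *(1)] gal_restrict[OF assms *(2)]]
    by (auto simp: compose_def subset_iff fun_eq_iff)
qed

end

section \<open>Frobenius elements and units\<close>

locale kummer_frobenius = kummer p \<zeta> K
  for p :: nat and \<zeta> :: "'a::{alg_closed_field, field_char_0}" and K :: "'a set" +
  fixes S\<^sub>0 T :: "('a \<Rightarrow> int) set" and S\<^sub>r :: "('a \<Rightarrow> real) set"
    and w :: "('a \<Rightarrow> int) \<Rightarrow> ('a \<Rightarrow> int)" and \<sigma> :: "('a \<Rightarrow> int) \<Rightarrow> ('a \<Rightarrow> 'a)"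
  assumes T: "finite T" "T \<subseteq> finite_places K" "S\<^sub>0 \<inter> T = {}"
    and norm: "\<And>v. v \<in> T \<Longrightarrow> [place_norm K v = 1] (mod p)"
    and w: "\<And>v. v \<in> T \<Longrightarrow> lies_over K (w v) v"
    and frob: "\<And>v. v \<in> T \<Longrightarrow> is_frobenius (F_field p \<zeta> K {} S\<^sub>0 S\<^sub>r) K' (w v) (\<sigma> v)"
    and indep: "fp_independent p (Gamma_group p \<zeta> K {} S\<^sub>0 S\<^sub>r) \<sigma> T"
begin

abbreviation E where "E \<equiv> E_group K {} S\<^sub>0 S\<^sub>r"
abbreviation E\<^sub>T where "E\<^sub>T \<equiv> E_group K T S\<^sub>0 S\<^sub>r"
abbreviation F where "F \<equiv> adjoin K' (pth_roots E)"
abbreviation F\<^sub>T where "F\<^sub>T \<equiv> adjoin K' (pth_roots E\<^sub>T)"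
abbreviation \<Gamma> where "\<Gamma> \<equiv> gal_group F K'"
abbreviation \<Gamma>\<^sub>T where "\<Gamma>\<^sub>T \<equiv> gal_group F\<^sub>T K'"

lemma F_field_eq: "F_field p \<zeta> K {} S\<^sub>0 S\<^sub>r = F" "F_field p \<zeta> K T S\<^sub>0 S\<^sub>r = F\<^sub>T"
  by (simp_all add: F_field_def)

lemma Gamma_group_eq: "Gamma_group p \<zeta> K {} S\<^sub>0 S\<^sub>r = \<Gamma>" "Gamma_group p \<zeta> K T S\<^sub>0 S\<^sub>r = \<Gamma>\<^sub>T"
  by (simp_all add: Gamma_group_def F_field_eq)

section \<open>The groups \<open>E\<close> and \<open>E\<^sub>T\<close> and the \<open>p\<close>-th
  roots of their elements\<close>

lemma E_sub: "E \<subseteq> K - {0}" "E\<^sub>T \<subseteq> E" "E\<^sub>T \<subseteq> K - {0}"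
  by (auto simp: E_group_def)

lemma E_T_iff: "x \<in> E\<^sub>T \<longleftrightarrow> x \<in> E \<and> (\<forall>v\<in>T. x - 1 \<in> valuation_ideal K v)"
  by (auto simp: E_group_def)

lemma E_place: "x \<in> E \<Longrightarrow> v \<in> finite_places K \<Longrightarrow> v \<notin> S\<^sub>0 \<Longrightarrow> v x = 0"
  and E_real: "x \<in> E \<Longrightarrow> u \<in> real_places K \<Longrightarrow> u \<notin> S\<^sub>r \<Longrightarrow> 0 < u x"
  by (auto simp: E_group_def)

lemma T_notin_S\<^sub>0: "v \<in> T \<Longrightarrow> v \<notin> S\<^sub>0" using T(3) by auto

lemma E_sub_valuation_ring: "x \<in> E \<Longrightarrow> v \<in> T \<Longrightarrow> x \<in> valuation_ring K v"
  using E_sub(1) T(2) T_notin_S\<^sub>0 E_place[of x v] by (auto simp: valuation_ring_def)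

lemma E_I:
  assumes "x \<in> K" "x \<noteq> 0" "\<And>v. v \<in> finite_places K \<Longrightarrow> v \<notin> S\<^sub>0 \<Longrightarrow> v x = 0"
    and "\<And>u. u \<in> real_places K \<Longrightarrow> u \<notin> S\<^sub>r \<Longrightarrow> 0 < u x"
  shows "x \<in> E"
  using assms by (auto simp: E_group_def)

lemma E_closed:
  "1 \<in> E" "x \<in> E \<Longrightarrow> y \<in> E \<Longrightarrow> x * y \<in> E" "x \<in> E \<Longrightarrow> inverse x \<in> E"
  "x \<in> E \<Longrightarrow> y \<in> E \<Longrightarrow> x / y \<in> E" "x \<in> E \<Longrightarrow> x ^ n \<in> E"
proof -
  note c = subfield_closed[OF K]
  have E: "x \<in> K" "x \<noteq> 0" if "x \<in> E" for x using that E_sub(1) by auto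
  show one: "1 \<in> E"
    by (rule E_I) (simp_all add: c place_one[OF K] real_place_simps(1)[OF K])
  show mult: "x * y \<in> E" if "x \<in> E" "y \<in> E" for x y
    by (rule E_I) (simp_all add: c E that place_mult[OF K] real_place_simps(2)[OF K] E_place E_real)
  have v: "v (inverse x) = - v x" if "x \<in> K" "x \<noteq> 0" "v \<in> finite_places K" for x and v :: "'a \<Rightarrow> int"
    using place_divide[OF K that(3) c(2) that(1)] that place_one[OF K that(3)] by (simp add: inverse_eq_divide)
  show inv: "inverse x \<in> E" if "x \<in> E" for x
    by (rule E_I) (simp_all add: c E that v real_place_simps(3)[OF K] E_place E_real)
  show "x / y \<in> E" if "x \<in> E" "y \<in> E"
    using mult[OF that(1) inv[OF that(2)]] by (simp add: divide_inverse)
  show "x ^ n \<in> E" if "x \<in> E"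
    by (induction n) (auto simp: one mult that)
qed

lemma roots_closed:
  "y \<in> pth_roots E \<Longrightarrow> z \<in> pth_roots E \<Longrightarrow> y * z \<in> pth_roots E"
  "y \<in> pth_roots E \<Longrightarrow> z \<in> pth_roots E \<Longrightarrow> y / z \<in> pth_roots E"
  "\<zeta> ^ i \<in> pth_roots E"
  "(\<And>i. i \<in> I \<Longrightarrow> f i \<in> pth_roots E) \<Longrightarrow> prod f I \<in> pth_roots E"
  "y \<in> pth_roots E \<Longrightarrow> y ^ n \<in> pth_roots E"
proof -
  show mult: "y * z \<in> pth_roots E" if "y \<in> pth_roots E" "z \<in> pth_roots E" for y z
    using that E_closed(2) by (simp add: power_mult_distrib)
  show "y / z \<in> pth_roots E" if "y \<in> pth_roots E" "z \<in> pth_roots E"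
    using that E_closed(4) by (simp add: power_divide)
  have "(\<zeta> ^ i) ^ p = 1" using zeta_power_p by (metis mult.commute power_mult power_one)
  then show "\<zeta> ^ i \<in> pth_roots E" using E_closed(1) by simp
  show "prod f I \<in> pth_roots E" if "\<And>i. i \<in> I \<Longrightarrow> f i \<in> pth_roots E"
    using that by (induction I rule: infinite_finite_induct) (auto simp: E_closed(1) mult simp del: mem_Collect_eq)
  show "y ^ n \<in> pth_roots E" if "y \<in> pth_roots E"
  proof -
    have "(y ^ n) ^ p = (y ^ p) ^ n" by (metis mult.commute power_mult)
    then show ?thesis using E_closed(5) that by simp
  qed
qed

lemmas F_props = L_props[OF E_sub(1)]
lemmas FT_props = L_props[OF E_sub(3)]
lemmas F_closed = subfield_closed[OF F_props(1)]
lemmas root_nz' = root_nz[OF E_sub(1)]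

lemma FT_sub_F: "F\<^sub>T \<subseteq> F"
  by (rule adjoin_mono) (use E_sub(2) in auto)

section \<open>The Frobenius action on \<open>p\<close>-th roots\<close>

lemma sigma_gal: "v \<in> T \<Longrightarrow> \<sigma> v \<in> carrier \<Gamma>"
  using frob by (auto simp: is_frobenius_def F_field_eq)

lemmas gal_simps = field_aut_simps[OF F_props(1) gal_autD(1)[OF E_sub(1)]]
lemmas gal_zeta = gal_autD(5)[OF E_sub(1)]
lemmas gal_fix = gal_autD(3)[OF E_sub(1)]

lemma gal_fix_E: "\<tau> \<in> carrier \<Gamma> \<Longrightarrow> x \<in> E \<Longrightarrow> \<tau> x = x"
  using gal_fix E_sub(1) K'_props(2) by blast

lemma gal_root': assumes "\<tau> \<in> carrier \<Gamma>" "y \<in> pth_roots E" obtains i where "i < p" "\<tau> y = \<zeta> ^ i * y"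
  using gal_root[OF E_sub(1) assms] by blast

text \<open>Gathers what holds at a place \<open>W\<close> of \<open>F\<close> over
  \<open>v\<close>. As the norm of \<open>v\<close> is 1 modulo \<open>p\<close>, \<open>W\<close>
  is not above \<open>p\<close>. A \<open>p\<close>-th root \<open>y\<close> of an element of
  \<open>E\<close> has \<open>W y = 0\<close>, because the value of \<open>y ^ p\<close> at
  \<open>v\<close> is 0, \<open>v\<close> being outside \<open>S\<^sub>0\<close>.\<close>

lemma frobenius_place:
  assumes "v \<in> T"
  obtains W N where "W \<in> finite_places F" "lies_over K W v" "of_nat p \<notin> valuation_ideal F W"
    "\<forall>x\<in>valuation_ring F W. \<sigma> v x - x ^ N \<in> valuation_ideal F W"
    "pth_roots E \<subseteq> valuation_ring F W"
proof -
  obtain W where W: "W \<in> finite_places F" "lies_over K' W (w v)"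
    and fr: "\<forall>x\<in>valuation_ring F W. \<sigma> v x - x ^ place_norm K' (w v) \<in> valuation_ideal F W"
    using frob[OF assms] by (auto simp: is_frobenius_def F_field_eq)
  have v: "v \<in> finite_places K" using assms T by auto
  have over: "lies_over K W v" by (rule lies_over_trans[OF K'_props(2) W(2) w[OF assms]])
  have "of_nat p \<notin> valuation_ideal K v" by (rule place_norm_cong_one(2)[OF K v prime_p norm[OF assms]])
  then have p: "of_nat p \<notin> valuation_ideal F W"
    using lies_over_valuation_ideal[OF F_props(5) over] subfield_closed(10)[OF K] by blast
  have "y \<in> valuation_ring F W" if y: "y \<in> pth_roots E" for y
  proof -
    have yF: "y \<in> F" "y \<noteq> 0" using F_props(3) y root_nz'[OF y] by auto
    obtain e where e: "\<forall>x\<in>K - {0}. W x = e * v x" using over by (auto simp: lies_over_def)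
    have x: "y ^ p \<in> E" "y ^ p \<in> K - {0}" using y E_sub(1) by auto
    have "v (y ^ p) = 0" using E_place[OF x(1) v] assms T(3) by auto
    then have "W (y ^ p) = 0" using bspec[OF e x(2)] by simp
    then have "W y = 0" using place_power[OF F_props(1) W(1) yF, of p] p_pos by simp
    then show ?thesis using yF by (simp add: valuation_ring_def)
  qed
  then show thesis using that[OF W(1) over p fr] by blast
qed

lemma sigma_fixes_roots_E_T:
  assumes v: "v \<in> T" and y: "y \<in> pth_roots E\<^sub>T"
  shows "\<sigma> v y = y"
proof -
  obtain W N where W: "W \<in> finite_places F" "lies_over K W v" "of_nat p \<notin> valuation_ideal F W"
    and fr': "\<forall>x\<in>valuation_ring F W. \<sigma> v x - x ^ N \<in> valuation_ideal F W"
    and int': "pth_roots E \<subseteq> valuation_ring F W"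
    by (rule frobenius_place[OF v])
  note fr = bspec[OF fr'] and int = subsetD[OF int']
  note ideal = valuation_ideal_closed[OF F_props(1) W(1)]
  have yE: "y \<in> pth_roots E" using y E_sub(2) by auto
  have yF: "y \<in> F" using yE F_props(3) by blast
  have "y ^ p \<in> K" using y E_sub(3) by auto
  then have "y ^ p - 1 \<in> K" using subfield_closed(2,6)[OF K] by blast
  moreover have "y ^ p - 1 \<in> valuation_ideal K v" using y v by (auto simp: E_T_iff)
  ultimately have "y ^ p - 1 \<in> valuation_ideal F W"
    using lies_over_valuation_ideal[OF F_props(5) W(2)] by blast
  moreover have "\<zeta> \<in> F" using F_props(4)[of 1] by simp
  ultimately obtain i where i: "i < p" "y - \<zeta> ^ i \<in> valuation_ideal F W"
    using root_of_unity_cong[OF F_props(1) W(1) \<zeta> p_pos _ yF] by blast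
  \<comment> \<open>Dividing by \<open>\<zeta> ^ i\<close>, whose inverse is
    \<open>\<zeta> ^ (p - i)\<close>, reduces to a root congruent to 1.\<close>
  define z where "z = \<zeta> ^ (p - i) * y"
  have z: "z \<in> pth_roots E" using roots_closed(1)[OF roots_closed(3) yE] by (simp add: z_def)
  have "z - 1 = \<zeta> ^ (p - i) * (y - \<zeta> ^ i)"
    using i(1) zeta_power_p by (simp add: z_def right_diff_distrib flip: power_add)
  then have z1: "z - 1 \<in> valuation_ideal F W"
    using ideal(5)[OF int[OF roots_closed(3)] i(2)] by metis
  obtain j where j: "\<sigma> v z = \<zeta> ^ j * z" by (rule gal_root'[OF sigma_gal[OF v] z])
  \<comment> \<open>Combines the Frobenius congruence for \<open>z\<close> with \<open>z\<close> and
    \<open>z ^ N\<close> being congruent to 1; the whole expression collapses to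
    \<open>\<zeta> ^ j - 1\<close>.\<close>
  have "(\<sigma> v z - z ^ N) + (z ^ N - 1) - \<zeta> ^ j * (z - 1) \<in> valuation_ideal F W"
    using ideal(2,4,5) fr[OF int[OF z]] power_cong_one[OF F_props(1) W(1) z1] int[OF roots_closed(3)] z1
    by metis
  then have "\<zeta> ^ j - 1 \<in> valuation_ideal F W" by (simp add: j algebra_simps)
  moreover have "(\<zeta> ^ j) ^ p = 1" using zeta_power_p by (metis mult.commute power_mult power_one)
  ultimately have "\<zeta> ^ j = 1" using root_of_unity_cong_one[OF F_props(1) W(1,3)] by blast
  then have "\<zeta> ^ (p - i) * \<sigma> v y = \<zeta> ^ (p - i) * y"
    using j gal_zeta[OF sigma_gal[OF v] yF] by (simp add: z_def)
  then show ?thesis using zeta_nz by simp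
qed

lemma sigma_exponents:
  assumes "y \<in> pth_roots E"
  obtains l where "\<And>v. v \<in> T \<Longrightarrow> \<sigma> v y = \<zeta> ^ l v * y"
proof -
  have "\<forall>v\<in>T. \<exists>i. \<sigma> v y = \<zeta> ^ i * y"
    using gal_root'[OF sigma_gal assms] by metis
  then show thesis using that by metis
qed

text \<open>Dualises independence. The exponent vectors of all roots form a group \<open>V\<close>
  of integer vectors. A functional killing \<open>V\<close> modulo \<open>p\<close> gives a
  combination of the \<open>\<sigma> v\<close> that fixes every root, hence is trivial, so its
  coefficients vanish modulo \<open>p\<close>; by duality \<open>V\<close> contains every vector
  modulo \<open>p\<close>.\<close>

lemma sigma_surj: obtains y where "y \<in> pth_roots E" "\<And>v. v \<in> T \<Longrightarrow> \<sigma> v y = \<zeta> ^ t v * y"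
proof -
  define V where "V = {f :: ('a \<Rightarrow> int) \<Rightarrow> int. \<exists>y\<in>pth_roots E. \<forall>v\<in>T. \<sigma> v y = \<zeta> powi f v * y}"
  have "\<exists>f\<in>V. \<forall>v\<in>T. [f v = int (t v)] (mod int p)"
  proof (rule annihilator_exists[OF T(1) prime_p])
    show "(\<lambda>_. 0) \<in> V"
      using gal_simps(2)[OF sigma_gal] E_closed(1) by (auto simp: V_def intro!: exI[of _ 1])
  next
    fix f g assume "f \<in> V" "g \<in> V"
    then obtain y z where y: "y \<in> pth_roots E" "\<forall>v\<in>T. \<sigma> v y = \<zeta> powi f v * y"
      and z: "z \<in> pth_roots E" "\<forall>v\<in>T. \<sigma> v z = \<zeta> powi g v * z" unfolding V_def by blast
    have "\<sigma> v (y / z) = \<zeta> powi (f v - g v) * (y / z)" if "v \<in> T" for v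
      using gal_simps(10)[OF sigma_gal[OF that], of y z] y z that F_props(3) zeta_nz
      by (auto simp: power_int_diff)
    then show "(\<lambda>v. f v - g v) \<in> V"
      using roots_closed(2)[OF y(1) z(1)] unfolding V_def by blast
  next
    fix c :: "('a \<Rightarrow> int) \<Rightarrow> int"
    assume c: "\<And>f. f \<in> V \<Longrightarrow> int p dvd (\<Sum>v\<in>T. c v * f v)"
    define d where "d v = nat (c v mod int p)" for v
    have d: "d \<in> T \<rightarrow> {..<p}" using p_pos by (auto simp: d_def nat_less_iff)
    have dc: "[int (d v) = c v] (mod int p)" for v using p_pos by (simp add: d_def cong_def)
    have "fp_lincomb \<Gamma> \<sigma> T d = \<one>\<^bsub>\<Gamma>\<^esub>"
    proof (rule gal_eqI[OF E_sub(1) fp_lincomb_closed[OF E_sub(1) sigma_gal]])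
      show "\<one>\<^bsub>\<Gamma>\<^esub> \<in> carrier \<Gamma>"
        using group.is_monoid[OF gal_group_group[OF F_props(1,2)]] by (rule monoid.one_closed)
    next
      fix y assume y: "y \<in> pth_roots E"
      obtain l where l: "\<And>v. v \<in> T \<Longrightarrow> \<sigma> v y = \<zeta> ^ l v * y" using sigma_exponents[OF y] by blast
      have yF: "y \<in> F" using y F_props(3) by blast
      have "(\<lambda>v. int (l v)) \<in> V" using y l unfolding V_def by auto
      then have "int p dvd (\<Sum>v\<in>T. c v * int (l v))" by (rule c)
      moreover have "[\<Sum>v\<in>T. int (d v) * int (l v) = (\<Sum>v\<in>T. c v * int (l v))] (mod int p)"
        by (intro cong_sum cong_scalar_right dc)
      ultimately have "int p dvd int (\<Sum>v\<in>T. d v * l v)" by (simp add: cong_dvd_iff)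
      then have "p dvd (\<Sum>v\<in>T. d v * l v)" by (simp only: int_dvd_int_iff)
      then have "\<zeta> ^ (\<Sum>v\<in>T. d v * l v) = 1" using primitive_root_pow_eq_1_iff[OF \<zeta> p_pos] by blast
      then show "fp_lincomb \<Gamma> \<sigma> T d y = \<one>\<^bsub>\<Gamma>\<^esub> y"
        using fp_lincomb_root[OF E_sub(1) T(1) sigma_gal yF l] yF by (simp add: gal_group_one)
    qed
    then have "\<forall>v\<in>T. d v = 0" using indep d unfolding fp_independent_def Gamma_group_eq by blast
    then show "\<forall>v\<in>T. int p dvd c v" using dc by (auto simp: cong_iff_dvd_diff dvd_diff_commute)
        (metis cong_0_iff cong_sym dc of_nat_0)
  qed
  then obtain f y where "\<forall>v\<in>T. [f v = int (t v)] (mod int p)" "y \<in> pth_roots E"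
    "\<forall>v\<in>T. \<sigma> v y = \<zeta> powi f v * y" unfolding V_def by blast
  then show thesis using that[of y] zeta_powi_cong by fastforce
qed

text \<open>The counting lemma for \<open>E\<close> modulo \<open>E\<^sub>T\<close>. The exponent
  vectors \<open>T \<rightarrow>\<^sub>E {..<p}\<close> serve twice: they index elements of
  \<open>E\<close> in distinct classes modulo \<open>D\<close>, supplied by
  \<open>sigma_surj\<close>, and they record the residues at \<open>T\<close> of the
  \<open>p\<close>-torsion modulo \<open>E\<^sub>T\<close>. Both bounds are therefore the same
  number.\<close>

lemma fixed_root_decomp:
  assumes y: "y \<in> pth_roots E" and fixed: "\<And>v. v \<in> T \<Longrightarrow> \<sigma> v y = y"
  obtains z where "z \<in> E" "y / z \<in> pth_roots E\<^sub>T"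
proof -
  define D where "D = {x \<in> E. \<forall>y. y ^ p = x \<longrightarrow> (\<forall>v\<in>T. \<sigma> v y = y)}"
  define f where "f t = (SOME y. y \<in> pth_roots E \<and> (\<forall>v\<in>T. \<sigma> v y = \<zeta> ^ t v * y))" for t :: "('a \<Rightarrow> int) \<Rightarrow> nat"
  have f: "f t \<in> pth_roots E \<and> (\<forall>v\<in>T. \<sigma> v (f t) = \<zeta> ^ t v * f t)" for t
    unfolding f_def by (rule someI_ex) (metis sigma_surj)
  \<comment> \<open>Two elements of \<open>E\<close> have the same tuple of residue classes exactly
    when their quotient lies in \<open>E\<^sub>T\<close>.\<close>
  define r where "r x = (\<lambda>v\<in>T. (\<lambda>i. i + x) ` valuation_ideal K v)" for x
  have "\<forall>v\<in>T. \<exists>W. W \<in> finite_places F \<and> lies_over K W v" using frobenius_place by metis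
  then obtain Wp where Wp: "\<And>v. v \<in> T \<Longrightarrow> Wp v \<in> finite_places F" "\<And>v. v \<in> T \<Longrightarrow> lies_over K (Wp v) v"
    by metis
  \<comment> \<open>The root of unity to which \<open>x\<close> is congruent at each place of
    \<open>T\<close>. As \<zeta> need not lie in \<open>K\<close>, the congruence is read at places
    of \<open>F\<close>.\<close>
  define \<phi> where "\<phi> x = (\<lambda>v\<in>T. SOME i. i < p \<and> x - \<zeta> ^ i \<in> valuation_ideal F (Wp v))" for x
  let ?I = "T \<rightarrow>\<^sub>E {..<p}"
  have Tfp: "v \<in> finite_places K" if "v \<in> T" for v using T that by auto
  have fixD: "x \<in> D" if "x \<in> E" "y ^ p = x" "\<And>v. v \<in> T \<Longrightarrow> \<sigma> v y = y" for x y
  proof -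
    \<comment> \<open>\<open>D\<close> speaks of all \<open>p\<close>-th roots of \<open>x\<close>,
      but they differ by powers of \<zeta>, so one fixed root suffices.\<close>
    have "\<sigma> v y' = y'" if y': "y' ^ p = x" "v \<in> T" for y' v
    proof -
      have yE: "y \<in> pth_roots E" using \<open>x \<in> E\<close> \<open>y ^ p = x\<close> by simp
      obtain i where i: "y' = \<zeta> ^ i * y"
        using root_quotient[of y' y] y'(1) \<open>y ^ p = x\<close> root_nz'[OF yE] by metis
      have "y \<in> F" using yE F_props(3) by blast
      then have "\<sigma> v y' = \<zeta> ^ i * \<sigma> v y" unfolding i by (rule gal_zeta[OF sigma_gal[OF y'(2)]])
      then show ?thesis using \<open>\<And>v. v \<in> T \<Longrightarrow> \<sigma> v y = y\<close> y'(2) i by simp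
    qed
    then show ?thesis using \<open>x \<in> E\<close> by (simp add: D_def)
  qed
  have quot: "x / y \<in> E\<^sub>T \<longleftrightarrow> (\<forall>v\<in>T. x - y \<in> valuation_ideal K v)" if xy: "x \<in> E" "y \<in> E" for x y
  proof -
    have "x / y - 1 \<in> valuation_ideal K v \<longleftrightarrow> x - y \<in> valuation_ideal K v" if v: "v \<in> T" for v
    proof -
      \<comment> \<open>\<open>y\<close> is a unit at \<open>v\<close>, so multiplying or dividing
        by it does not affect the congruence.\<close>
      have u: "y \<in> valuation_ring K v" "inverse y \<in> valuation_ring K v"
        using E_sub_valuation_ring E_closed(3) xy(2) v by auto
      have y: "y \<noteq> 0" using E_sub(1) xy(2) by auto
      have "x - y = y * (x / y - 1)" "x / y - 1 = inverse y * (x - y)"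
        using y by (simp_all add: field_simps)
      then show ?thesis
        using valuation_ideal_closed(5)[OF K Tfp[OF v] u(1)] valuation_ideal_closed(5)[OF K Tfp[OF v] u(2)]
        by metis
    qed
    then show ?thesis using E_closed(4)[OF xy] by (simp add: E_T_iff)
  qed
  have \<phi>: "\<phi> x v < p \<and> x - \<zeta> ^ \<phi> x v \<in> valuation_ideal F (Wp v)"
    if "x \<in> E" "x ^ p \<in> E\<^sub>T" "v \<in> T" for x v
  proof -
    have "x \<in> K" "x ^ p - 1 \<in> K" using that(1) E_sub(1) subfield_closed(2,6,9)[OF K] by blast+
    moreover have "x ^ p - 1 \<in> valuation_ideal K v" using that by (simp add: E_T_iff)
    ultimately have "x \<in> F" "x ^ p - 1 \<in> valuation_ideal F (Wp v)"
      using lies_over_valuation_ideal[OF F_props(5) Wp(2)[OF that(3)]] F_props(5) by blast+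
    moreover have "\<zeta> \<in> F" using F_props(4)[of 1] by simp
    ultimately have "\<exists>i. i < p \<and> x - \<zeta> ^ i \<in> valuation_ideal F (Wp v)"
      using root_of_unity_cong[OF F_props(1) Wp(1)[OF that(3)] \<zeta> p_pos] by metis
    then show ?thesis using that(3) someI_ex[of "\<lambda>i. i < p \<and> x - \<zeta> ^ i \<in> valuation_ideal F (Wp v)"]
      by (simp add: \<phi>_def)
  qed
  have yD: "y ^ p \<in> D" using fixD[of "y ^ p" y] y fixed by blast
  obtain z where "z \<in> E" "y ^ p / z ^ p \<in> E\<^sub>T"
  proof (rule pth_powers_mod_eqI[where G = E and N = "E\<^sub>T" and D = D and I = ?I and J = ?I and r = r
        and f = "\<lambda>t. f t ^ p" and \<phi> = \<phi> and p = p and d = "y ^ p"])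
    show "0 \<notin> E" using E_sub(1) by auto
    show "r x = r y \<longleftrightarrow> x / y \<in> E\<^sub>T" if "x \<in> E" "y \<in> E" for x y
    proof -
      have "r x = r y \<longleftrightarrow> (\<forall>v\<in>T. (\<lambda>i. i + x) ` valuation_ideal K v = (\<lambda>i. i + y) ` valuation_ideal K v)"
        by (auto simp: r_def fun_eq_iff)
      also have "\<dots> \<longleftrightarrow> (\<forall>v\<in>T. x - y \<in> valuation_ideal K v)"
        using residue_class_eq_iff[OF K Tfp] by blast
      finally show ?thesis using quot[OF that] by simp
    qed
    have "r ` E \<subseteq> PiE T (\<lambda>v. carrier (residue_field K v))"
    proof clarify
      fix x assume x: "x \<in> E"
      then have "x \<in> valuation_ring K v" if "v \<in> T" for v
        using E_sub_valuation_ring that by blast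
      then show "r x \<in> PiE T (\<lambda>v. carrier (residue_field K v))"
        using residue_field_carrier[OF K Tfp] by (auto simp: r_def)
    qed
    then show "finite (r ` E)"
      by (rule finite_subset) (intro finite_PiE T(1) place_norm_cong_one(1)[OF K Tfp prime_p norm])
    show "D \<subseteq> E" by (auto simp: D_def)
    show "x / y \<in> D" if "x \<in> D" "y \<in> D" for x y
    proof -
      have xy: "x \<in> E" "y \<in> E" using that by (auto simp: D_def)
      obtain a b where ab: "a ^ p = x" "b ^ p = y" using pth_root_exists by metis
      then have "a \<in> F" "b \<in> F" using xy F_props(3) by auto
      then have "\<sigma> v (a / b) = a / b" if v: "v \<in> T" for v
        using gal_simps(10)[OF sigma_gal[OF v]] ab \<open>x \<in> D\<close> \<open>y \<in> D\<close> v by (auto simp: D_def)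
      then show ?thesis using fixD[of "x / y" "a / b"] E_closed(4)[OF xy] ab by (simp add: power_divide)
    qed
    show "E\<^sub>T \<subseteq> D" using E_sub(2) sigma_fixes_roots_E_T by (auto simp: D_def)
    show "x ^ p \<in> D" if "x \<in> E" for x
      by (rule fixD[OF E_closed(5)[OF that] refl]) (rule gal_fix_E[OF sigma_gal that])
    show "f t ^ p \<in> E" if "t \<in> ?I" for t using f[of t] by simp
    show "s = t" if "s \<in> ?I" "t \<in> ?I" "f s ^ p / f t ^ p \<in> D" for s t
    proof (rule PiE_ext[OF that(1,2)])
      fix v assume v: "v \<in> T"
      have F: "f s \<in> F" "f t \<in> F" and nz: "f s \<noteq> 0" "f t \<noteq> 0"
        using f F_props(3) root_nz' by blast+
      \<comment> \<open>\<open>f s / f t\<close> is a root of an element of \<open>D\<close>, hence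
        fixed; comparison with the prescribed exponents gives \<open>s v = t v\<close>.\<close>
      have "\<sigma> v (f s / f t) = f s / f t"
        using that(3) v by (auto simp: D_def simp flip: power_divide)
      moreover have "\<sigma> v (f s / f t) = (\<zeta> ^ s v * f s) / (\<zeta> ^ t v * f t)"
        using gal_simps(10)[OF sigma_gal[OF v] F] f v by simp
      ultimately have "\<zeta> ^ s v = \<zeta> ^ t v" using nz zeta_nz by (simp add: field_simps)
      moreover have "s v < p" "t v < p" using that v by auto
      ultimately show "s v = t v" by (intro primitive_root_pow_inj[OF \<zeta> p_pos])
    qed
    show "\<phi> x \<in> ?I" if "x \<in> E" "x ^ p \<in> E\<^sub>T" for x
      using \<phi>[OF that] by (auto simp: \<phi>_def)
    show "x / y \<in> E\<^sub>T" if x: "x \<in> E" "x ^ p \<in> E\<^sub>T" and y: "y \<in> E" "y ^ p \<in> E\<^sub>T" and eq: "\<phi> x = \<phi> y" for x y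
    proof -
      have "x - y \<in> valuation_ideal K v" if v: "v \<in> T" for v
      proof -
        \<comment> \<open>\<open>x\<close> and \<open>y\<close> are congruent to the same root of
          unity in \<open>F\<close>; their difference lies in \<open>K\<close>, where the congruence
          then holds too.\<close>
        have "(x - \<zeta> ^ \<phi> x v) - (y - \<zeta> ^ \<phi> y v) \<in> valuation_ideal F (Wp v)"
          by (rule valuation_ideal_closed(4)[OF F_props(1) Wp(1)[OF v]]) (use \<phi>[OF x v] \<phi>[OF y v] in auto)
        then have "x - y \<in> valuation_ideal F (Wp v)" by (simp add: eq)
        moreover have "x - y \<in> K" using x y E_sub(1) subfield_closed(6)[OF K] by blast
        ultimately show ?thesis using lies_over_valuation_ideal[OF F_props(5) Wp(2)[OF v]] by blast
      qed
      then show ?thesis using quot x y by blast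
    qed
    show "finite ?I" "finite ?I" by (simp_all add: finite_PiE T(1))
    show "?I \<noteq> {}" using p_pos by (auto simp: PiE_eq_empty_iff)
  qed (use E_closed yD in auto)
  then show thesis using that[of z] by (simp add: power_divide)
qed

section \<open>Roots dual to the Frobenius elements, and generation of \<open>F\<close> over
  \<open>F\<^sub>T\<close>\<close>

definition dual_root :: "('a \<Rightarrow> int) \<Rightarrow> 'a" where
  "dual_root u = (SOME y. y \<in> pth_roots E \<and> (\<forall>v\<in>T. \<sigma> v y = \<zeta> ^ (if v = u then 1 else 0) * y))"

lemma dual_root:
  "dual_root u \<in> pth_roots E" "v \<in> T \<Longrightarrow> \<sigma> v (dual_root u) = (if v = u then \<zeta> else 1) * dual_root u"
proof -
  have "\<exists>y. y \<in> pth_roots E \<and> (\<forall>v\<in>T. \<sigma> v y = \<zeta> ^ (if v = u then 1 else 0) * y)"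
    by (rule sigma_surj[of "\<lambda>v. if v = u then 1 else 0"]) blast
  then have "dual_root u \<in> pth_roots E \<and> (\<forall>v\<in>T. \<sigma> v (dual_root u) = \<zeta> ^ (if v = u then 1 else 0) * dual_root u)"
    unfolding dual_root_def by (rule someI_ex)
  then show "dual_root u \<in> pth_roots E"
    "v \<in> T \<Longrightarrow> \<sigma> v (dual_root u) = (if v = u then \<zeta> else 1) * dual_root u" by auto
qed

text \<open>Dividing \<open>y\<close> by the product of dual roots with the same exponents leaves a
  root fixed by every \<open>\<sigma> v\<close>, to which \<open>fixed_root_decomp\<close>
  applies.\<close>

lemma root_decomp:
  assumes y: "y \<in> pth_roots E" and l: "\<And>v. v \<in> T \<Longrightarrow> \<sigma> v y = \<zeta> ^ l v * y"
  obtains z t where "z \<in> E" "t \<in> pth_roots E\<^sub>T" "y = z * t * (\<Prod>u\<in>T. dual_root u ^ l u)"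
proof -
  define d where "d = (\<Prod>u\<in>T. dual_root u ^ l u)"
  have d: "d \<in> pth_roots E" unfolding d_def by (intro roots_closed(4,5) dual_root(1))
  have nz: "d \<noteq> 0" by (rule root_nz'[OF d])
  have dF: "d \<in> F" "y \<in> F" using d y F_props(3) by auto
  have "\<sigma> v (y / d) = y / d" if v: "v \<in> T" for v
  proof -
    note s = gal_simps[OF sigma_gal[OF v]]
    have F: "dual_root u \<in> F" for u using dual_root(1) F_props(3) by blast
    have "\<sigma> v d = (\<Prod>u\<in>T. \<sigma> v (dual_root u) ^ l u)"
      unfolding d_def by (subst s(13)) (auto simp: F_closed(9) F s(11))
    also have "\<dots> = (\<Prod>u\<in>T. (if v = u then \<zeta> else 1) ^ l u * dual_root u ^ l u)"
      by (simp add: dual_root(2)[OF v] power_mult_distrib)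
    also have "\<dots> = (\<Prod>u\<in>T. if v = u then \<zeta> ^ l u else 1) * d"
      unfolding d_def prod.distrib by (simp add: if_distrib[of "\<lambda>x. x ^ _"] cong: if_cong)
    \<comment> \<open>Only the factor belonging to \<open>v\<close> itself is moved by
      \<open>\<sigma> v\<close>.\<close>
    also have "(\<Prod>u\<in>T. if v = u then \<zeta> ^ l u else 1) = \<zeta> ^ l v"
      using v T(1) by simp
    finally show ?thesis using s(10)[OF dF(2,1)] l[OF v] zeta_nz by simp
  qed
  then obtain z where z: "z \<in> E" "(y / d) / z \<in> pth_roots E\<^sub>T"
    using fixed_root_decomp[OF roots_closed(2)[OF y d]] by blast
  have "z \<noteq> 0" using z(1) E_sub(1) by auto
  then have "y = z * ((y / d) / z) * d" using nz by simp
  then show thesis using that[OF z] unfolding d_def by blast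
qed

text \<open>In the decomposition of a root, \<open>z\<close> lies in \<open>K\<close> and
  \<open>t\<close> in \<open>F\<^sub>T\<close>, so only the dual roots have to be adjoined.\<close>

lemma F_generated: "F = adjoin F\<^sub>T (dual_root ` T)"
proof
  let ?M = "adjoin F\<^sub>T (dual_root ` T)"
  note c = subfield_closed[OF adjoin_subfield[of "F\<^sub>T" "dual_root ` T"]]
  have incl: "F\<^sub>T \<subseteq> ?M" "dual_root ` T \<subseteq> ?M" by (rule adjoin_incl)+
  have "pth_roots E \<subseteq> ?M"
  proof
    fix y assume y: "y \<in> pth_roots E"
    obtain l where l: "\<And>v. v \<in> T \<Longrightarrow> \<sigma> v y = \<zeta> ^ l v * y" using sigma_exponents[OF y] by blast
    obtain z t where zt: "z \<in> E" "t \<in> pth_roots E\<^sub>T" "y = z * t * (\<Prod>u\<in>T. dual_root u ^ l u)"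
      by (rule root_decomp[OF y l])
    have "z \<in> ?M" "t \<in> ?M" using zt(1,2) E_sub(1) FT_props(3,5) incl(1) by blast+
    moreover have "(\<Prod>u\<in>T. dual_root u ^ l u) \<in> ?M" using incl(2) by (intro c(9,12)) auto
    ultimately show "y \<in> ?M" unfolding zt(3) by (intro c(4))
  qed
  then show "F \<subseteq> ?M" using FT_props(2) incl(1) by (intro adjoin_least[OF adjoin_subfield subset_trans])
  show "?M \<subseteq> F"
    by (rule adjoin_least[OF F_props(1) FT_sub_F]) (use dual_root(1) F_props(3) in auto)
qed

section \<open>Restriction of automorphisms from \<open>F\<close> to
  \<open>F\<^sub>T\<close>\<close>

lemma sigma_fixes_F_T: "v \<in> T \<Longrightarrow> x \<in> F\<^sub>T \<Longrightarrow> \<sigma> v x = x"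
proof -
  assume v: "v \<in> T" and "x \<in> F\<^sub>T"
  show "\<sigma> v x = x"
    using \<open>x \<in> F\<^sub>T\<close>
  proof (induction rule: adjoin_induct)
    case (gen y) then show ?case by (rule sigma_fixes_roots_E_T[OF v])
  qed (use FT_sub_F in \<open>auto simp: subset_iff gal_simps[OF sigma_gal[OF v]] gal_fix[OF sigma_gal[OF v]]\<close>)
qed

text \<open>An automorphism of \<open>F\<^sub>T\<close> is extended along the dual roots one at a
  time. When \<open>dual_root u\<close> is adjoined, \<open>\<sigma> u\<close> plays the part of
  \<sigma> in \<open>kummer_extend_aut\<close>.\<close>

lemma restrict_surj:
  "(\<lambda>\<tau>. restrict \<tau> F\<^sub>T) ` carrier \<Gamma> = carrier \<Gamma>\<^sub>T"
proof
  show "(\<lambda>\<tau>. restrict \<tau> F\<^sub>T) ` carrier \<Gamma> \<subseteq> carrier \<Gamma>\<^sub>T"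
    using gal_restrict[OF E_sub(2,1)] by blast
  show "carrier \<Gamma>\<^sub>T \<subseteq> (\<lambda>\<tau>. restrict \<tau> F\<^sub>T) ` carrier \<Gamma>"
  proof
    fix \<rho> assume \<rho>: "\<rho> \<in> carrier \<Gamma>\<^sub>T"
    note r = gal_autD[OF E_sub(3) \<rho>]
    have "\<exists>\<tau>\<in>field_auts (adjoin F\<^sub>T (dual_root ` U)). \<forall>x\<in>F\<^sub>T. \<tau> x = \<rho> x" if "finite U" "U \<subseteq> T" for U
      using that
    proof (induction U rule: finite_induct)
      case empty
      have "adjoin F\<^sub>T {} = F\<^sub>T"
        using adjoin_least[OF FT_props(1) subset_refl] adjoin_incl(1)[of "F\<^sub>T" "{}"] by auto
      then show ?case using r(1) by auto
    next
      case (insert u U)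
      let ?M = "adjoin F\<^sub>T (dual_root ` U)"
      obtain \<tau> where \<tau>: "\<tau> \<in> field_auts ?M" "\<And>x. x \<in> F\<^sub>T \<Longrightarrow> \<tau> x = \<rho> x"
        using insert by auto
      have u: "u \<in> T" "u \<notin> U" using insert by auto
      note s = gal_simps[OF sigma_gal[OF u(1)]]
      have sub: "?M \<subseteq> F"
        by (rule adjoin_least[OF F_props(1) FT_sub_F]) (use dual_root(1) F_props(3) in auto)
      have FM: "F\<^sub>T \<subseteq> ?M" by (rule adjoin_incl)
      \<comment> \<open>\<open>\<sigma> u\<close> fixes the dual roots already adjoined, since their
        indices differ from \<open>u\<close>.\<close>
      have fixM: "\<sigma> u m = m" if "m \<in> ?M" for m
        using that
      proof (induction rule: adjoin_induct)
        case (gen y)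
        then show ?case using dual_root(2)[OF u(1)] u(2) by auto
      qed (use sub s sigma_fixes_F_T[OF u(1)] in \<open>auto simp: subset_iff\<close>)
      have y: "dual_root u \<in> F" "dual_root u \<noteq> 0" "dual_root u ^ p \<in> K"
        using dual_root(1)[of u] F_props(3) E_sub(1) root_nz' by auto
      have z: "\<zeta> \<in> ?M" and a: "dual_root u ^ p \<in> F\<^sub>T"
        using FT_props(4)[of 1] FT_props(5) FM y(3) by auto
      have 1: "\<tau> (dual_root u ^ p) = dual_root u ^ p" using \<tau>(2)[OF a] r(3) y(3) K'_props(2) by auto
      have 2: "\<sigma> u (dual_root u) = \<zeta> * dual_root u" using dual_root(2)[OF u(1), of u] by simp
      have 3: "dual_root u ^ p \<in> ?M" using a FM by blast
      obtain \<tau>' where "\<tau>' \<in> field_auts (adjoin ?M {dual_root u})"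
          "\<forall>x\<in>?M. \<tau>' x = \<tau> x" "\<tau>' (dual_root u) = dual_root u"
        by (rule kummer_extend_aut[OF adjoin_subfield \<tau>(1) F_props(1) sub y(1)
            gal_autD(1)[OF E_sub(1) sigma_gal[OF u(1)]] fixM 2 y(2) \<zeta> z p_pos 3 1])
      moreover have "adjoin F\<^sub>T (dual_root ` insert u U) = adjoin ?M {dual_root u}"
        by (simp only: image_insert adjoin_insert[of "F\<^sub>T" "dual_root u" "dual_root ` U"])
      moreover have "\<tau>' x = \<rho> x" if "x \<in> F\<^sub>T" for x
        using \<open>\<forall>x\<in>?M. \<tau>' x = \<tau> x\<close> \<tau>(2)[OF that] FM that by auto
      ultimately show ?case by metis
    qed
    from this[OF T(1) subset_refl] obtain \<tau> where \<tau>: "\<tau> \<in> field_auts F" "\<And>x. x \<in> F\<^sub>T \<Longrightarrow> \<tau> x = \<rho> x"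
      unfolding F_generated[symmetric] by blast
    \<comment> \<open>Elements of the Galois group must be extensional, which \<tau> need not
      be.\<close>
    have "restrict \<tau> F \<in> carrier \<Gamma>"
      using \<tau> r(3) FT_props(2) F_props(2) F_closed(2-4) by (auto simp: gal_group_carrier field_auts_iff subset_iff)
    moreover have "restrict (restrict \<tau> F) F\<^sub>T = \<rho>"
      using \<tau>(2) FT_sub_F by (intro extensionalityI[OF _ r(2)]) auto
    ultimately show "\<rho> \<in> (\<lambda>\<tau>. restrict \<tau> F\<^sub>T) ` carrier \<Gamma>"
      by (intro image_eqI[of _ _ "restrict \<tau> F"]) simp_all
  qed
qed

text \<open>Combinations of the \<open>\<sigma> v\<close> fix \<open>F\<^sub>T\<close> because each
  \<open>\<sigma> v\<close> does. Conversely, an automorphism fixing \<open>F\<^sub>T\<close> is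
  determined by its exponents at the dual roots, and these exponents are the coefficients of the
  combination.\<close>

lemma restrict_kernel: "kernel \<Gamma> \<Gamma>\<^sub>T (\<lambda>\<tau>. restrict \<tau> F\<^sub>T) = fp_span p \<Gamma> \<sigma> T"
proof
  show "fp_span p \<Gamma> \<sigma> T \<subseteq> kernel \<Gamma> \<Gamma>\<^sub>T (\<lambda>\<tau>. restrict \<tau> F\<^sub>T)"
  proof
    fix \<tau> assume "\<tau> \<in> fp_span p \<Gamma> \<sigma> T"
    then obtain c where \<tau>: "\<tau> = fp_lincomb \<Gamma> \<sigma> T c" by (auto simp: fp_span_def)
    have G: "\<tau> \<in> carrier \<Gamma>" unfolding \<tau> by (rule fp_lincomb_closed[OF E_sub(1) sigma_gal])
    have "restrict \<tau> F\<^sub>T = \<one>\<^bsub>\<Gamma>\<^sub>T\<^esub>"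
    proof (rule gal_eqI[OF E_sub(3)])
      show "restrict \<tau> F\<^sub>T \<in> carrier \<Gamma>\<^sub>T" by (rule gal_restrict[OF E_sub(2,1) G])
      show "\<one>\<^bsub>\<Gamma>\<^sub>T\<^esub> \<in> carrier \<Gamma>\<^sub>T"
        using group.is_monoid[OF gal_group_group[OF FT_props(1,2)]] by (rule monoid.one_closed)
      fix y assume y: "y \<in> pth_roots E\<^sub>T"
      then have F: "y \<in> F\<^sub>T" "y \<in> F" using FT_props(3) FT_sub_F by blast+
      have "\<tau> y = \<zeta> ^ (\<Sum>v\<in>T. c v * 0) * y" unfolding \<tau>
        by (rule fp_lincomb_root[OF E_sub(1) T(1) sigma_gal F(2)])
          (use sigma_fixes_roots_E_T[OF _ y] in simp_all)
      then show "restrict \<tau> F\<^sub>T y = \<one>\<^bsub>\<Gamma>\<^sub>T\<^esub> y" using F by (simp add: gal_group_one)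
    qed
    then show "\<tau> \<in> kernel \<Gamma> \<Gamma>\<^sub>T (\<lambda>\<tau>. restrict \<tau> F\<^sub>T)" using G by (simp add: kernel_def)
  qed
  show "kernel \<Gamma> \<Gamma>\<^sub>T (\<lambda>\<tau>. restrict \<tau> F\<^sub>T) \<subseteq> fp_span p \<Gamma> \<sigma> T"
  proof
    fix \<tau> assume "\<tau> \<in> kernel \<Gamma> \<Gamma>\<^sub>T (\<lambda>\<tau>. restrict \<tau> F\<^sub>T)"
    then have G: "\<tau> \<in> carrier \<Gamma>" and 1: "restrict \<tau> F\<^sub>T = (\<lambda>x\<in>F\<^sub>T. x)"
      by (simp_all add: kernel_def gal_group_one)
    have fixFT: "\<tau> x = x" if "x \<in> F\<^sub>T" for x using fun_cong[OF 1, of x] that by simp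
    note t = gal_simps[OF G]
    have "\<exists>i<p. \<tau> (dual_root u) = \<zeta> ^ i * dual_root u" for u
      by (rule gal_root'[OF G dual_root(1)[of u]]) blast
    then obtain c where c: "\<And>u. c u < p" "\<And>u. \<tau> (dual_root u) = \<zeta> ^ c u * dual_root u" by metis
    have "\<tau> = fp_lincomb \<Gamma> \<sigma> T c"
    proof (rule gal_eqI[OF E_sub(1) G fp_lincomb_closed[OF E_sub(1) sigma_gal]])
      fix y assume y: "y \<in> pth_roots E"
      obtain l where l: "\<And>v. v \<in> T \<Longrightarrow> \<sigma> v y = \<zeta> ^ l v * y" using sigma_exponents[OF y] by blast
      obtain z s where zs: "z \<in> E" "s \<in> pth_roots E\<^sub>T" "y = z * s * (\<Prod>u\<in>T. dual_root u ^ l u)"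
        by (rule root_decomp[OF y l])
      have yF: "y \<in> F" using y F_props(3) by blast
      have zsT: "z * s \<in> F\<^sub>T"
        using zs(1,2) E_sub(1) FT_props(3,5) by (intro subfield_closed(4)[OF FT_props(1)]) blast+
      have F: "dual_root u \<in> F" for u using dual_root(1) F_props(3) by blast
      have "\<tau> (\<Prod>u\<in>T. dual_root u ^ l u) = (\<Prod>u\<in>T. \<tau> (dual_root u) ^ l u)"
        by (subst t(13)) (auto simp: F_closed(9) F t(11))
      also have "\<dots> = (\<Prod>u\<in>T. \<zeta> ^ (c u * l u)) * (\<Prod>u\<in>T. dual_root u ^ l u)"
        by (simp add: c(2) power_mult_distrib power_mult prod.distrib)
      \<comment> \<open>The factor \<open>z * s\<close> lies in \<open>F\<^sub>T\<close> and is
        fixed, so only the dual roots contribute; the result is the exponent that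
        \<open>fp_lincomb_root\<close> gives.\<close>
      finally have "\<tau> y = \<zeta> ^ (\<Sum>u\<in>T. c u * l u) * y"
        using t(7)[OF subsetD[OF FT_sub_F zsT] F_closed(12)[of T "\<lambda>u. dual_root u ^ l u", OF F_closed(9)[OF F]]]
          fixFT[OF zsT]
        by (simp add: zs(3) power_sum mult_ac)
      then show "\<tau> y = fp_lincomb \<Gamma> \<sigma> T c y"
        using fp_lincomb_root[OF E_sub(1) T(1) sigma_gal yF l] by simp
    qed
    then show "\<tau> \<in> fp_span p \<Gamma> \<sigma> T" using c(1) by (auto simp: fp_span_def)
  qed
qed

text \<open>The first isomorphism theorem for restriction to \<open>F\<^sub>T\<close>, read in the
  opposite direction.\<close>

lemma Gamma_T_iso:
  "Gamma_group p \<zeta> K T S\<^sub>0 S\<^sub>r \<cong>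
    Gamma_group p \<zeta> K {} S\<^sub>0 S\<^sub>r Mod fp_span p (Gamma_group p \<zeta> K {} S\<^sub>0 S\<^sub>r) \<sigma> T"
proof -
  interpret \<Gamma>: group \<Gamma> by (rule gal_group_group[OF F_props(1,2)])
  interpret \<Gamma>\<^sub>T: group \<Gamma>\<^sub>T by (rule gal_group_group[OF FT_props(1,2)])
  interpret group_hom \<Gamma> \<Gamma>\<^sub>T "\<lambda>\<tau>. restrict \<tau> F\<^sub>T"
    by unfold_locales (rule gal_restrict_hom[OF E_sub(2,1)])
  have iso: "\<Gamma> Mod fp_span p \<Gamma> \<sigma> T \<cong> \<Gamma>\<^sub>T"
    using FactGroup_iso[OF restrict_surj] by (simp only: restrict_kernel)
  have "group (\<Gamma> Mod fp_span p \<Gamma> \<sigma> T)"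
    using normal.factorgroup_is_group[OF normal_kernel] by (simp only: restrict_kernel)
  then show ?thesis unfolding Gamma_group_eq using iso by (rule group.iso_sym)
qed

end

theorem proposition1p2:
  fixes p :: nat
    and K :: "'a::{alg_closed_field, field_char_0} set"
    and S\<^sub>0 T :: "('a \<Rightarrow> int) set"
    and S\<^sub>r :: "('a \<Rightarrow> real) set"
    and \<zeta> :: 'a
    and w :: "('a \<Rightarrow> int) \<Rightarrow> ('a \<Rightarrow> int)"
    and \<sigma> :: "('a \<Rightarrow> int) \<Rightarrow> ('a \<Rightarrow> 'a)"
  assumes "prime p"
    and "number_field K"
    and "finite S\<^sub>0" "S\<^sub>0 \<subseteq> finite_places K"
    and "finite S\<^sub>r" "S\<^sub>r \<subseteq> real_places K"
    and "finite T" "T \<subseteq> finite_places K"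
    and "S\<^sub>0 \<inter> T = {}"
    and "\<And>v. v \<in> T \<Longrightarrow> [place_norm K v = 1] (mod p)"
    and "p > 2 \<Longrightarrow> S\<^sub>r = real_places K"
    and "primitive_root p \<zeta>"
    and "\<And>v. v \<in> T \<Longrightarrow> w v \<in> finite_places (adjoin K {\<zeta>}) \<and> lies_over K (w v) v"
    and "\<And>v. v \<in> T \<Longrightarrow> is_frobenius (F_field p \<zeta> K {} S\<^sub>0 S\<^sub>r) (adjoin K {\<zeta>}) (w v) (\<sigma> v)"
    and "fp_independent p (Gamma_group p \<zeta> K {} S\<^sub>0 S\<^sub>r) \<sigma> T"
  shows "Gamma_group p \<zeta> K T S\<^sub>0 S\<^sub>r \<cong>
         Gamma_group p \<zeta> K {} S\<^sub>0 S\<^sub>r Mod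
           fp_span p (Gamma_group p \<zeta> K {} S\<^sub>0 S\<^sub>r) \<sigma> T"
proof -
  interpret kummer p \<zeta> K
    by (rule kummer.intro) (use assms(1,2,12) in \<open>simp_all add: number_field_def\<close>)
  interpret kummer_frobenius p \<zeta> K S\<^sub>0 T S\<^sub>r w \<sigma>
    by (intro kummer_frobenius.intro kummer_frobenius_axioms.intro kummer_axioms)
      (use assms(7-15) in simp_all)
  show ?thesis by (rule Gamma_T_iso)
qed

end
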